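(* Let $\Delta>0$ and $c>e$ (with $\Delta<c$). If $\bar m=2p-1\ne0$ is sufficiently small in absolute value (depending on $c$ and $\Delta$), then the variational formula $$\lim_{N\to+\infty}\bar F_N(t,\mu_1,\mu_2)=\sup_{\nu_1\in\mathcal{M}_{1/2}}\ \sup_{\nu_2\in\mathcal{M}_p}\mathcal{P}_{t,\mu_1,\mu_2}(\nu_1,\nu_2)$$ with $\mu_1=\mu_2=0$ does not hold in a neighborhood of $t=0$; that is, there is no $\delta>0$ such that this formula with $\mu_1=\mu_2=0$ holds for all $t\in[0,\delta)$.
   Context: **Basic notation.** $c>0$ and $\Delta\in(-c,c)\setminus\{0\}$ are fixed. $\Sigma_N=\{-1,+1\}^N$. Let $P^X$ be the uniform probability measure on $\{-1,1\}$ and $P^Y$ the probability measure on $\{-1,1\}$ with $P^Y\{1\}=p$, where $p\in(0,1)$, $p\ne1/2$; $\bar m=2p-1$. $P_N^X=(P^X)^{\otimes N}$, $P_N^Y=(P^Y)^{\otimes N}$. $\mathcal{M}_+$ is the set of non-negative finite measures on $[-1,1]$. For $q\in(0,1)$, $\mathcal{M}_q$ is the set of probability measures on $[-1,1]$ with mean $2q-1$ (so $\mathcal{M}_{1/2}$ consists of the centered ones and $\mathcal{M}_p$ of those with mean $\bar m$). **Bipartite enriched free energy.** Let $(X,Y)\sim P_N^X\otimes P_N^Y$ (with $N$ large enough that all probabilities below lie in $(0,1)$). For $t\ge0$ let $\Pi_t$ be Poisson with mean $tN^2$, $(i_k,j_k)_{k\ge1}$ i.i.d. uniform on $\{1,\dots,N\}^2$,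 and $(G^k_{i,j})$ $\{0,1\}$-valued, independent conditionally on $(X,Y)$, with $\mathbb{P}\{G_{i,j}^k=1\mid X,Y\}=\frac{c+\Delta X_iY_j}{N}$. Set $$H_N^t(x,y)=\sum_{k\le\Pi_t}\log\Big[(c+\Delta x_{i_k}y_{j_k})^{G^k_{i_k,j_k}}\Big(1-\frac{c+\Delta x_{i_k}y_{j_k}}{N}\Big)^{1-G^k_{i_k,j_k}}\Big].$$ For $\mu_1,\mu_2\in\mathcal{M}_+$ let $(\Lambda_i(N\mu_1))_{i\le N}$ and $(\Lambda_i(N\mu_2))_{i\le N}$ be independent Poisson point processes with intensities $N\mu_1$ and $N\mu_2$, and set $$H_N^{\mu_1,\mu_2}(x,y)=\sum_{i\le N}\sum_{z\in\Lambda_i(N\mu_1)}\log\Big[(c+\Delta x_iz)^{G_i^{z,X}}\Big(1-\frac{c+\Delta x_iz}{N}\Big)^{1-G_i^{z,X}}\Big]+\sum_{i\le N}\sum_{z\in\Lambda_i(N\mu_2)}\log\Big[(c+\Delta y_iz)^{G_i^{z,Y}}\Big(1-\frac{c+\Delta y_iz}{N}\Big)^{1-G_i^{z,Y}}\Big],$$ where the $G$'s are conditionally independent, $\{0,1\}$-valued, with $\mathbb{P}\{G_i^{z,X}=1\mid X,z\}=\frac{c+\Delta X_iz}{N}$ and $\mathbb{P}\{G_i^{z,Y}=1\mid Y,z\}=\frac{c+\Delta Y_iz}{N}$. The randomness in the two Hamiltonians is independent conditionally on $(X,Y)$. Put $$\bar F_N(t,\mu_1,\mu_2)=\frac1N\mathbb{E}\log\int_{\Sigma_N^2}\exp\big(H_N^t(x,y)+H_N^{\mu_1,\mu_2}(x,y)\big)\,dP_N^X(x)\,dP_N^Y(y).$$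 **The functional.** Let $g(z)=(c+\Delta z)(\log(c+\Delta z)-1)$ for $z\in[-1,1]$. For $P\in\{P^X,P^Y\}$ let $$\psi_P(\mu)=-c\,\mu[-1,1]+\mathbb{E}\log\int_{\{-1,1\}}\exp\Big(-\Delta\sigma\int_{-1}^1x\,d\mu(x)\Big)\prod_{x\in\Pi_*(\mu)}(c+\Delta\sigma x)\,dP(\sigma),$$ where $\epsilon^*\sim P$ and, conditionally on $\epsilon^*$, $\Pi_*(\mu)$ is a Poisson point process on $[-1,1]$ with intensity $(c+\Delta\epsilon^*x)\,d\mu(x)$. Write $\psi_X=\psi_{P^X}$, $\psi_Y=\psi_{P^Y}$, and $$\mathcal{P}_{t,\mu_1,\mu_2}(\nu_1,\nu_2)=\psi_X(\mu_1+t\nu_1)+\psi_Y(\mu_2+t\nu_2)-t\int_{-1}^1\int_{-1}^1g(xy)\,d\nu_1(x)\,d\nu_2(y).$$ *)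

theory Defs
  imports "HOL-Probability.Probability"
begin

section \<open>Spins and measures on $[-1,1]$\<close>

definition spin_pmf :: "real \<Rightarrow> real pmf" where
  "spin_pmf q = map_pmf (\<lambda>b. if b then 1 else -1) (bernoulli_pmf q)"

text \<open>The product law on configurations; coordinates outside \<open>{1..N}\<close> are frozen at 0.\<close>
definition spins_pmf :: "real \<Rightarrow> nat \<Rightarrow> (nat \<Rightarrow> real) pmf" where
  "spins_pmf q N = Pi_pmf {1..N} 0 (\<lambda>_. spin_pmf q)"

abbreviation unit_borel :: "real measure" where
  "unit_borel \<equiv> restrict_space borel {-1..1}"

definition prob_with_mean :: "real \<Rightarrow> real measure set" where
  "prob_with_mean q =
    {\<nu>. sets \<nu> = sets unit_borel \<and> prob_space \<nu> \<and> (\<integral>x. x \<partial>\<nu>) = 2 * q - 1}"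

text \<open>\<open>plus_scaled \<mu> t \<nu>\<close> is the measure $\mu + t\nu$, for $t \ge 0$.\<close>
definition plus_scaled :: "real measure \<Rightarrow> real \<Rightarrow> real measure \<Rightarrow> real measure" where
  "plus_scaled \<mu> t \<nu> =
    measure_of (space \<mu>) (sets \<mu>) (\<lambda>A. emeasure \<mu> A + ennreal t * emeasure \<nu> A)"

lemma space_plus_scaled [simp]: "space (plus_scaled \<mu> t \<nu>) = space \<mu>"
  by (simp add: plus_scaled_def space_measure_of_conv)

lemma sets_plus_scaled [simp]: "sets (plus_scaled \<mu> t \<nu>) = sets \<mu>"
  by (simp add: plus_scaled_def)

lemma emeasure_plus_scaled:
  assumes "sets \<nu> = sets \<mu>" "A \<in> sets \<mu>"
  shows "emeasure (plus_scaled \<mu> t \<nu>) A = emeasure \<mu> A + ennreal t * emeasure \<nu> A"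
  unfolding plus_scaled_def
proof (rule emeasure_measure_of_sigma)
  show "countably_additive (sets \<mu>) (\<lambda>A. emeasure \<mu> A + ennreal t * emeasure \<nu> A)"
  proof (rule countably_additiveI)
    fix A :: "nat \<Rightarrow> real set"
    assume "range A \<subseteq> sets \<mu>" "disjoint_family A" "\<Union> (range A) \<in> sets \<mu>"
    then show "(\<Sum>i. emeasure \<mu> (A i) + ennreal t * emeasure \<nu> (A i)) =
        emeasure \<mu> (\<Union> (range A)) + ennreal t * emeasure \<nu> (\<Union> (range A))"
      using assms(1) by (simp add: suminf_add[symmetric] suminf_emeasure)
  qed
qed (use assms in \<open>auto simp: positive_def sets.sigma_algebra_axioms\<close>)


section \<open>Poisson point processes\<close>

text \<open>The library's \<^const>\<open>poisson_pmf\<close> is only specified for a strictly positive rate.\<close>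
definition poisson_law :: "real \<Rightarrow> nat pmf" where
  "poisson_law r = (if r = 0 then return_pmf 0 else poisson_pmf r)"

text \<open>For the zero measure there is nothing to normalise; an arbitrary point mass is used,
  so that the result is always a probability measure.\<close>
definition normalised :: "real measure \<Rightarrow> real measure" where
  "normalised \<mu> = (if emeasure \<mu> (space \<mu>) = 0 then return \<mu> 0
     else scale_measure (1 / emeasure \<mu> (space \<mu>)) \<mu>)"

text \<open>A pair \<open>(n, z)\<close> encodes the finite configuration of points \<open>z 0, \<dots>, z (n - 1)\<close>, counted
  with multiplicity; the remaining values of \<open>z\<close> are irrelevant. The Poisson point process with
  finite intensity measure \<open>\<mu>\<close> consists of a Poisson number, with mean the total mass of \<open>\<mu>\<close>, of
  independent points sampled from \<open>\<mu>\<close> normalised to a probability measure.\<close>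
type_synonym config = "nat \<times> (nat \<Rightarrow> real)"

definition poisson_process :: "real measure \<Rightarrow> config measure" where
  "poisson_process \<mu> =
    measure_pmf (poisson_law (measure \<mu> (space \<mu>))) \<Otimes>\<^sub>M (\<Pi>\<^sub>M k\<in>UNIV. normalised \<mu>)"

definition poisson_family :: "nat \<Rightarrow> real measure \<Rightarrow> (nat \<Rightarrow> config) measure" where
  "poisson_family N \<mu> = (\<Pi>\<^sub>M i\<in>{1..N}. poisson_process (scale_measure (of_nat N) \<mu>))"


section \<open>The enriched free energy\<close>

text \<open>In the following, \<open>s\<close> stands for the product of the two interacting variables and \<open>b\<close> for
  the value of the observation \<open>G\<close>.\<close>
definition edge_prob :: "real \<Rightarrow> real \<Rightarrow> nat \<Rightarrow> real \<Rightarrow> real" where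
  "edge_prob c \<Delta> N s = (c + \<Delta> * s) / real N"

definition edge_weight :: "real \<Rightarrow> real \<Rightarrow> nat \<Rightarrow> real \<Rightarrow> bool \<Rightarrow> real" where
  "edge_weight c \<Delta> N s b =
    (c + \<Delta> * s) ^ of_bool b * (1 - (c + \<Delta> * s) / real N) ^ of_bool (\<not> b)"

text \<open>Conditional law, given the signal \<open>(X, Y)\<close>, of the number \<open>n\<close> of terms, the pairs of indices
  and the observations \<open>G (k, i, j)\<close> entering the first Hamiltonian. Only the labels \<open>k \<le> n\<close> are
  sampled, since no others enter.\<close>
definition graph_data ::
  "real \<Rightarrow> real \<Rightarrow> nat \<Rightarrow> real \<Rightarrow> (nat \<Rightarrow> real) \<Rightarrow> (nat \<Rightarrow> real) \<Rightarrow>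
    (nat \<times> (nat \<Rightarrow> nat \<times> nat) \<times> (nat \<times> nat \<times> nat \<Rightarrow> bool)) pmf" where
  "graph_data c \<Delta> N t X Y = do {
     n \<leftarrow> poisson_law (t * real N ^ 2);
     ij \<leftarrow> Pi_pmf {1..n} (0, 0) (\<lambda>_. pmf_of_set ({1..N} \<times> {1..N}));
     G \<leftarrow> Pi_pmf ({1..n} \<times> {1..N} \<times> {1..N}) False
       (\<lambda>(k, i, j). bernoulli_pmf (edge_prob c \<Delta> N (X i * Y j)));
     return_pmf (n, ij, G)
   }"

definition graph_hamiltonian ::
  "real \<Rightarrow> real \<Rightarrow> nat \<Rightarrow> nat \<times> (nat \<Rightarrow> nat \<times> nat) \<times> (nat \<times> nat \<times> nat \<Rightarrow> bool) \<Rightarrow>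
    (nat \<Rightarrow> real) \<Rightarrow> (nat \<Rightarrow> real) \<Rightarrow> real" where
  "graph_hamiltonian c \<Delta> N = (\<lambda>(n, ij, G) x y.
     \<Sum>k = 1..n. case ij k of (i, j) \<Rightarrow> ln (edge_weight c \<Delta> N (x i * y j) (G (k, i, j))))"

text \<open>Conditional law, given the signal \<open>X\<close> and the points \<open>\<Lambda>\<close>, of the observations \<open>G (i, k)\<close>
  attached to the \<open>k\<close>-th point of \<open>\<Lambda> i\<close>.\<close>
definition point_data ::
  "real \<Rightarrow> real \<Rightarrow> nat \<Rightarrow> (nat \<Rightarrow> real) \<Rightarrow> (nat \<Rightarrow> config) \<Rightarrow> (nat \<times> nat \<Rightarrow> bool) pmf" where
  "point_data c \<Delta> N X \<Lambda> =
     Pi_pmf (SIGMA i:{1..N}. {..<fst (\<Lambda> i)}) False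
       (\<lambda>(i, k). bernoulli_pmf (edge_prob c \<Delta> N (X i * snd (\<Lambda> i) k)))"

definition point_hamiltonian ::
  "real \<Rightarrow> real \<Rightarrow> nat \<Rightarrow> (nat \<Rightarrow> config) \<Rightarrow> (nat \<times> nat \<Rightarrow> bool) \<Rightarrow> (nat \<Rightarrow> real) \<Rightarrow> real" where
  "point_hamiltonian c \<Delta> N \<Lambda> G x =
     (\<Sum>i = 1..N. \<Sum>k < fst (\<Lambda> i). ln (edge_weight c \<Delta> N (x i * snd (\<Lambda> i) k) (G (i, k))))"

text \<open>The overall expectation is taken successively over the signal, the data of the first
  Hamiltonian given the signal, the two independent families of point processes, and finally the
  observations at their points given signal and points. The innermost expectation is the integral
  over $\Sigma_N^2$ with respect to $P_N^X \otimes P_N^Y$.\<close>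
definition free_energy ::
  "real \<Rightarrow> real \<Rightarrow> real \<Rightarrow> nat \<Rightarrow> real \<Rightarrow> real measure \<Rightarrow> real measure \<Rightarrow> real" where
  "free_energy c \<Delta> p N t \<mu>1 \<mu>2 = 1 / real N *
    measure_pmf.expectation (pair_pmf (spins_pmf (1/2) N) (spins_pmf p N)) (\<lambda>(X, Y).
      measure_pmf.expectation (graph_data c \<Delta> N t X Y) (\<lambda>D.
        \<integral>(\<Lambda>1, \<Lambda>2).
          measure_pmf.expectation
            (pair_pmf (point_data c \<Delta> N X \<Lambda>1) (point_data c \<Delta> N Y \<Lambda>2)) (\<lambda>(G1, G2).
              ln (measure_pmf.expectation (pair_pmf (spins_pmf (1/2) N) (spins_pmf p N)) (\<lambda>(x, y).
                exp (graph_hamiltonian c \<Delta> N D x y +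
                  (point_hamiltonian c \<Delta> N \<Lambda>1 G1 x + point_hamiltonian c \<Delta> N \<Lambda>2 G2 y)))))
        \<partial>(poisson_family N \<mu>1 \<Otimes>\<^sub>M poisson_family N \<mu>2)))"


section \<open>The variational functional\<close>

definition g_fun :: "real \<Rightarrow> real \<Rightarrow> real \<Rightarrow> real" where
  "g_fun c \<Delta> z = (c + \<Delta> * z) * (ln (c + \<Delta> * z) - 1)"

definition psi :: "real \<Rightarrow> real \<Rightarrow> real pmf \<Rightarrow> real measure \<Rightarrow> real" where
  "psi c \<Delta> P \<mu> = - c * measure \<mu> (space \<mu>) +
    measure_pmf.expectation P (\<lambda>\<epsilon>.
      \<integral>(n, z).
        ln (measure_pmf.expectation P (\<lambda>\<sigma>.
          exp (- \<Delta> * \<sigma> * (\<integral>x. x \<partial>\<mu>)) * (\<Prod>k<n. c + \<Delta> * \<sigma> * z k)))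
      \<partial>poisson_process (density \<mu> (\<lambda>x. ennreal (c + \<Delta> * \<epsilon> * x))))"

definition parisi_functional ::
  "real \<Rightarrow> real \<Rightarrow> real \<Rightarrow> real \<Rightarrow> real measure \<Rightarrow> real measure \<Rightarrow>
    real measure \<Rightarrow> real measure \<Rightarrow> real" where
  "parisi_functional c \<Delta> p t \<mu>1 \<mu>2 \<nu>1 \<nu>2 =
    psi c \<Delta> (spin_pmf (1/2)) (plus_scaled \<mu>1 t \<nu>1) + psi c \<Delta> (spin_pmf p) (plus_scaled \<mu>2 t \<nu>2)
      - t * (\<integral>x. (\<integral>y. g_fun c \<Delta> (x * y) \<partial>\<nu>2) \<partial>\<nu>1)"

text \<open>The supremum is taken in the extended reals, where it always exists; a finite limit of
  real numbers is unaffected by this.\<close>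
definition variational_formula ::
  "real \<Rightarrow> real \<Rightarrow> real \<Rightarrow> real \<Rightarrow> real measure \<Rightarrow> real measure \<Rightarrow> bool" where
  "variational_formula c \<Delta> p t \<mu>1 \<mu>2 \<longleftrightarrow>
    (\<lambda>N. ereal (free_energy c \<Delta> p N t \<mu>1 \<mu>2)) \<longlonglongrightarrow>
      (SUP \<nu>1 \<in> prob_with_mean (1/2). SUP \<nu>2 \<in> prob_with_mean p.
        ereal (parisi_functional c \<Delta> p t \<mu>1 \<mu>2 \<nu>1 \<nu>2))"

end

theory Submission
  imports Defs
begin

text \<open>At \<open>\<mu>\<^sub>1 = \<mu>\<^sub>2 = 0\<close> both sides are compared to first order in \<open>t\<close>. Divide the partition
  function by the likelihood in which every product \<open>x\<^sub>i y\<^sub>j\<close> is replaced by 0; since \<open>X\<close> is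
  centred, the expected logarithm of this reference likelihood contributes \<open>t g(0)\<close> to the limit. By
  Jensen's inequality the remaining quotient contributes at most the logarithm of its mean, which
  equals \<open>E exp (s (\<Sum>\<^sub>i X\<^sub>i x\<^sub>i) (\<Sum>\<^sub>j Y\<^sub>j y\<^sub>j))\<close> with \<open>s = t \<Delta>\<^sup>2 / (c (N - c))\<close> and independent
  replicas. The \<open>X\<^sub>i x\<^sub>i\<close> are independent symmetric signs, so this is \<open>exp (O(N t\<^sup>2))\<close>, and the
  limit is at most \<open>t g(0) + O(t\<^sup>2)\<close>. On the other side the point masses at 0 and at
  \<open>m = 2 p - 1\<close> give at least \<open>t g(m\<^sup>2)\<close>, by Gibbs' inequality against a Poisson law of mean
  \<open>t (c + \<Delta> m\<^sup>2)\<close>. As \<open>g\<close> is strictly increasing where \<open>c + \<Delta> z > 1\<close>, the supremum exceeds the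
  limit for all small \<open>t > 0\<close>.\<close>

section \<open>Expectations under discrete laws\<close>

lemma integrable_and_expectation_pmf_nat:
  fixes p :: "nat pmf" and f :: "nat \<Rightarrow> real"
  assumes "summable (\<lambda>n. pmf p n * \<bar>f n\<bar>)"
  shows "integrable (measure_pmf p) f"
    and "measure_pmf.expectation p f = (\<Sum>n. pmf p n * f n)"
proof -
  have *: "integrable (count_space UNIV) (\<lambda>n. pmf p n *\<^sub>R f n)"
    using assms by (simp add: integrable_count_space_nat_iff abs_mult)
  show "integrable (measure_pmf p) f"
    unfolding measure_pmf_eq_density using * by (subst integrable_density) auto
  show "measure_pmf.expectation p f = (\<Sum>n. pmf p n * f n)"
    unfolding measure_pmf_eq_density using integral_count_space_nat[OF *]
    by (subst integral_density) auto
qed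

text \<open>The probability generating function of the Poisson law. It turns the \<open>n\<close>-th
  powers produced by \<open>n\<close> independent edges into exponentials.\<close>

lemma poisson_pmf_power:
  fixes r z :: real
  assumes "0 < r"
  shows "integrable (measure_pmf (poisson_pmf r)) (\<lambda>n. z ^ n)"
    and "measure_pmf.expectation (poisson_pmf r) (\<lambda>n. z ^ n) = exp (r * (z - 1))"
proof -
  have sums: "(\<lambda>n. pmf (poisson_pmf r) n * w ^ n) sums (exp (- r) * exp (r * w))" for w
    using sums_mult[OF exp_converges[of "r * w"], of "exp (- r)"] assms
    by (simp add: power_mult_distrib divide_inverse mult_ac)
  have "summable (\<lambda>n. pmf (poisson_pmf r) n * \<bar>z ^ n\<bar>)"
    using sums_summable[OF sums[of "\<bar>z\<bar>"]] by (simp add: power_abs)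
  note * = integrable_and_expectation_pmf_nat[OF this]
  show "integrable (measure_pmf (poisson_pmf r)) (\<lambda>n. z ^ n)" by (rule *)
  show "measure_pmf.expectation (poisson_pmf r) (\<lambda>n. z ^ n) = exp (r * (z - 1))"
    using *(2) sums_unique[OF sums[of z]] by (simp add: algebra_simps flip: exp_add)
qed

lemma poisson_pmf_mean:
  fixes r :: real
  assumes "0 < r"
  shows "integrable (measure_pmf (poisson_pmf r)) real"
    and "measure_pmf.expectation (poisson_pmf r) real = r"
proof -
  have "(\<lambda>n. r * exp (- r) * (r ^ n /\<^sub>R fact n)) sums (r * exp (- r) * exp r)"
    by (intro sums_mult exp_converges)
  then have "(\<lambda>n. pmf (poisson_pmf r) (Suc n) * real (Suc n)) sums r"
    using assms by (simp add: divide_simps mult_ac exp_minus del: of_nat_Suc)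
  then have sums: "(\<lambda>n. pmf (poisson_pmf r) n * real n) sums r"
    using sums_Suc_iff[of "\<lambda>n. pmf (poisson_pmf r) n * real n" r] by simp
  then have "summable (\<lambda>n. pmf (poisson_pmf r) n * \<bar>real n\<bar>)"
    by (auto simp: sums_iff)
  note * = integrable_and_expectation_pmf_nat[OF this]
  show "integrable (measure_pmf (poisson_pmf r)) real" by (rule *)
  show "measure_pmf.expectation (poisson_pmf r) real = r"
    using *(2) sums_unique[OF sums] by simp
qed

text \<open>A tower property for an outer law with infinite support, here the Poisson number of
  edges. The bound depends on the outer variable only, so the conditional expectations are dominated
  by an integrable function.\<close>

lemma expectation_bind_pmf_dominated:
  fixes f :: "'b \<Rightarrow> real"
  assumes bound: "\<And>x y. x \<in> set_pmf M \<Longrightarrow> y \<in> set_pmf (K x) \<Longrightarrow> \<bar>f y\<bar> \<le> B x"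
    and B: "integrable (measure_pmf M) B"
  shows "integrable (measure_pmf (bind_pmf M K)) f" (is ?int)
    and "measure_pmf.expectation (bind_pmf M K) f =
      measure_pmf.expectation M (\<lambda>x. measure_pmf.expectation (K x) f)" (is ?eq)
proof -
  \<comment> \<open>For nonnegative functions the identity is first obtained for nonnegative
    integrals; finiteness then comes from \<open>B\<close>.\<close>
  have nonneg: "integrable (measure_pmf (bind_pmf M K)) h \<and>
      measure_pmf.expectation (bind_pmf M K) h =
        measure_pmf.expectation M (\<lambda>x. measure_pmf.expectation (K x) h) \<and>
      integrable (measure_pmf M) (\<lambda>x. measure_pmf.expectation (K x) h) \<and>
      (\<forall>x\<in>set_pmf M. integrable (measure_pmf (K x)) h)"
    if h: "\<And>y. 0 \<le> h y" "\<And>y. h y \<le> \<bar>f y\<bar>" for h :: "'b \<Rightarrow> real"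
  proof -
    have int: "integrable (measure_pmf (K x)) h" if "x \<in> set_pmf M" for x
      using bound[OF that] h
      by (intro measure_pmf.integrable_const_bound[where B="B x"])
         (auto intro!: AE_pmfI order_trans[OF h(2)])
    have le: "measure_pmf.expectation (K x) h \<le> B x" if "x \<in> set_pmf M" for x
      using bound[OF that]
      by (intro measure_pmf.integral_le_const int that) (auto intro!: AE_pmfI order_trans[OF h(2)])
    have int2: "integrable (measure_pmf M) (\<lambda>x. measure_pmf.expectation (K x) h)"
      by (rule Bochner_Integration.integrable_bound[OF B])
         (auto intro!: AE_pmfI order_trans[OF le] simp: h integral_nonneg)
    have "(\<integral>\<^sup>+y. ennreal (h y) \<partial>measure_pmf (bind_pmf M K)) =
        (\<integral>\<^sup>+x. \<integral>\<^sup>+y. ennreal (h y) \<partial>measure_pmf (K x) \<partial>measure_pmf M)"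
      by simp
    also have "\<dots> = (\<integral>\<^sup>+x. ennreal (measure_pmf.expectation (K x) h) \<partial>measure_pmf M)"
      by (intro nn_integral_cong_AE AE_pmfI nn_integral_eq_integral int) (auto simp: h)
    also have "\<dots> = ennreal (measure_pmf.expectation M (\<lambda>x. measure_pmf.expectation (K x) h))"
      by (intro nn_integral_eq_integral int2) (auto simp: h integral_nonneg)
    finally have nn: "(\<integral>\<^sup>+y. ennreal (h y) \<partial>measure_pmf (bind_pmf M K)) =
      ennreal (measure_pmf.expectation M (\<lambda>x. measure_pmf.expectation (K x) h))" .
    have "has_bochner_integral (measure_pmf (bind_pmf M K)) h
        (measure_pmf.expectation M (\<lambda>x. measure_pmf.expectation (K x) h))"
      using nn by (intro has_bochner_integral_nn_integral) (auto simp: h integral_nonneg)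
    then show ?thesis
      using int int2 by (auto simp: has_bochner_integral_iff)
  qed
  \<comment> \<open>Positive and negative parts reduce the signed case to the nonnegative
    one.\<close>
  have f: "f = (\<lambda>y. max 0 (f y) - max 0 (- f y))"
    by (auto simp: max_def)
  have p: "\<And>y. max 0 (f y) \<le> \<bar>f y\<bar>" and n: "\<And>y. max 0 (- f y) \<le> \<bar>f y\<bar>"
    by auto
  note P = nonneg[of "\<lambda>y. max 0 (f y)", OF _ p, simplified]
  note N = nonneg[of "\<lambda>y. max 0 (- f y)", OF _ n, simplified]
  show ?int
    by (subst f) (use P N in auto)
  have "measure_pmf.expectation (bind_pmf M K) f =
      measure_pmf.expectation M (\<lambda>x. measure_pmf.expectation (K x) (\<lambda>y. max 0 (f y))) -
      measure_pmf.expectation M (\<lambda>x. measure_pmf.expectation (K x) (\<lambda>y. max 0 (- f y)))"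
    by (subst f) (use P N in auto)
  also have "\<dots> = measure_pmf.expectation M (\<lambda>x.
      measure_pmf.expectation (K x) (\<lambda>y. max 0 (f y)) - measure_pmf.expectation (K x) (\<lambda>y. max 0 (- f y)))"
    using P N by auto
  also have "\<dots> = measure_pmf.expectation M (\<lambda>x. measure_pmf.expectation (K x) f)"
    by (rule integral_cong_AE) (auto intro!: AE_pmfI simp: P N f[symmetric] simp flip: Bochner_Integration.integral_diff)
  finally show ?eq .
qed

lemma finite_set_Pi_pmf:
  assumes "finite A" "\<And>x. x \<in> A \<Longrightarrow> finite (set_pmf (p x))"
  shows "finite (set_pmf (Pi_pmf A d p))"
  by (rule finite_subset[OF set_Pi_pmf_subset'[OF assms(1)]]) (auto intro!: finite_PiE_dflt assms)

lemma expectation_pair_pmf_finite: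
  fixes f :: "'a \<times> 'b \<Rightarrow> real"
  assumes "finite (set_pmf p)" "finite (set_pmf q)"
  shows "measure_pmf.expectation (pair_pmf p q) f =
    measure_pmf.expectation p (\<lambda>x. measure_pmf.expectation q (\<lambda>y. f (x, y)))"
proof -
  have "measure_pmf.expectation (pair_pmf p q) f = 
    (\<Sum>z\<in>set_pmf p \<times> set_pmf q. pmf (pair_pmf p q) z *\<^sub>R f z)"
    using assms by (intro integral_measure_pmf) auto
  also have "\<dots> = (\<Sum>x\<in>set_pmf p. \<Sum>y\<in>set_pmf q. pmf p x * (pmf q y * f (x, y)))"
    unfolding sum.cartesian_product by (intro sum.cong) (auto simp: pmf_pair)
  also have "\<dots> = measure_pmf.expectation p (\<lambda>x. measure_pmf.expectation q (\<lambda>y. f (x, y)))"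
    using assms by (simp add: integral_measure_pmf[of "set_pmf p"] integral_measure_pmf[of "set_pmf q"]
        sum_distrib_left)
  finally show ?thesis .
qed

lemma expectation_bind_pmf_finite:
  fixes f :: "'b \<Rightarrow> real"
  assumes "finite (set_pmf p)" "\<And>x. x \<in> set_pmf p \<Longrightarrow> finite (set_pmf (K x))"
  shows "measure_pmf.expectation (bind_pmf p K) f =
    measure_pmf.expectation p (\<lambda>x. measure_pmf.expectation (K x) f)"
  using assms
  by (subst pmf_expectation_bind[of "set_pmf p"]) (auto simp: integral_measure_pmf[of "set_pmf p"])

lemma expectation_swap_finite:
  fixes f :: "'a \<Rightarrow> 'b \<Rightarrow> real"
  assumes "finite (set_pmf p)" "finite (set_pmf q)"
  shows "measure_pmf.expectation p (\<lambda>x. measure_pmf.expectation q (f x)) =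
    measure_pmf.expectation q (\<lambda>y. measure_pmf.expectation p (\<lambda>x. f x y))"
  using assms
  by (simp add: integral_measure_pmf[of "set_pmf p"] integrable_measure_pmf_finite)

lemma expectation_pmf_mono:
  fixes f g :: "'a \<Rightarrow> real"
  assumes "finite (set_pmf p)" "\<And>x. x \<in> set_pmf p \<Longrightarrow> f x \<le> g x"
  shows "measure_pmf.expectation p f \<le> measure_pmf.expectation p g"
  using assms by (intro integral_mono_AE integrable_measure_pmf_finite) (auto intro!: AE_pmfI)

lemma expectation_pmf_le_const:
  fixes f :: "'a \<Rightarrow> real"
  assumes "finite (set_pmf p)" "\<And>x. x \<in> set_pmf p \<Longrightarrow> f x \<le> a"
  shows "measure_pmf.expectation p f \<le> a"
  using expectation_pmf_mono[of p f "\<lambda>_. a"] assms by simp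

section \<open>Spin laws and the moment generating function of a sign\<close>

lemma expectation_spin_pmf:
  fixes f :: "real \<Rightarrow> real"
  assumes "0 \<le> q" "q \<le> 1"
  shows "measure_pmf.expectation (spin_pmf q) f = q * f 1 + (1 - q) * f (- 1)"
  using assms by (simp add: spin_pmf_def mult.commute)

lemma set_spin_pmf: "set_pmf (spin_pmf q) \<subseteq> {-1, 1}"
  by (auto simp: spin_pmf_def)

lemma finite_set_spin_pmf [simp]: "finite (set_pmf (spin_pmf q))"
  by (rule finite_subset[OF set_spin_pmf]) simp

lemma finite_set_spins_pmf [simp]: "finite (set_pmf (spins_pmf q N))"
  by (auto simp: spins_pmf_def intro!: finite_set_Pi_pmf)

lemma spins_pmfD:
  assumes "x \<in> set_pmf (spins_pmf q N)" "i \<in> {1..N}"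
  shows "x i = -1 \<or> x i = 1"
proof -
  have "x i \<in> set_pmf (spin_pmf q)"
    using assms by (auto simp: spins_pmf_def set_Pi_pmf PiE_dflt_def)
  then show ?thesis
    using set_spin_pmf by blast
qed

text \<open>\<open>cosh\<close> is the moment generating function of a symmetric sign, so this is
  its sub-Gaussian bound: Hoeffding's lemma for the fair two-point law.\<close>

lemma cosh_le_exp_square: "cosh (x::real) \<le> exp (x\<^sup>2 / 2)"
proof -
  have "cosh x \<le> exp (x\<^sup>2 / 2)" if "0 \<le> x" for x :: real
  proof -
    \<comment> \<open>Hoeffding's estimate with step \<open>2 * x\<close> and weight
      \<open>1 / 2\<close> bounds \<open>ln (1 + (exp (2 * x) - 1) / 2) - x\<close>, which is
      \<open>ln (cosh x)\<close>.\<close>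
    have "1 + (exp (2 * x) - 1) / 2 = exp x * cosh x"
      by (simp add: cosh_field_def field_simps flip: exp_add)
    then have "ln (cosh x) \<le> x\<^sup>2 / 2"
      using Hoeffdings_lemma_aux[of "2 * x" "1 / 2"] that
      by (simp add: ln_mult power_mult_distrib)
    then have "exp (ln (cosh x)) \<le> exp (x\<^sup>2 / 2)"
      by (simp only: exp_le_cancel_iff)
    then show ?thesis
      by (simp only: exp_ln cosh_real_pos)
  qed
  from this[of "\<bar>x\<bar>"] show ?thesis by simp
qed

section \<open>The random graph with a given number of edges\<close>

text \<open>\<open>graph_data\<close> conditioned on the Poisson number of terms. For positive
  \<open>N\<close> each layer has finite support, so only the number of terms calls for
  domination.\<close>

definition graph_layer ::
  "real \<Rightarrow> real \<Rightarrow> nat \<Rightarrow> (nat \<Rightarrow> real) \<Rightarrow> (nat \<Rightarrow> real) \<Rightarrow> nat \<Rightarrow>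
    (nat \<times> (nat \<Rightarrow> nat \<times> nat) \<times> (nat \<times> nat \<times> nat \<Rightarrow> bool)) pmf" where
  "graph_layer c \<Delta> N X Y n = do {
     ij \<leftarrow> Pi_pmf {1..n} (0, 0) (\<lambda>_. pmf_of_set ({1..N} \<times> {1..N}));
     G \<leftarrow> Pi_pmf ({1..n} \<times> {1..N} \<times> {1..N}) False
       (\<lambda>(k, i, j). bernoulli_pmf (edge_prob c \<Delta> N (X i * Y j)));
     return_pmf (n, ij, G)
   }"

lemma graph_data_eq_bind:
  "graph_data c \<Delta> N t X Y = poisson_law (t * real N ^ 2) \<bind> graph_layer c \<Delta> N X Y"
  by (simp add: graph_data_def graph_layer_def[abs_def])

lemma set_graph_layerE:
  assumes "D \<in> set_pmf (graph_layer c \<Delta> N X Y n)" "0 < N"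
  obtains ij G where "D = (n, ij, G)" "\<And>k. k \<in> {1..n} \<Longrightarrow> ij k \<in> {1..N} \<times> {1..N}"
proof -
  obtain ij G where D: "D = (n, ij, G)"
    and ij: "ij \<in> set_pmf (Pi_pmf {1..n} (0, 0) (\<lambda>_. pmf_of_set ({1..N} \<times> {1..N})))"
    using assms(1) by (auto simp: graph_layer_def)
  have "ij k \<in> {1..N} \<times> {1..N}" if "k \<in> {1..n}" for k
    using ij that assms(2) by (auto simp: set_Pi_pmf PiE_dflt_def set_pmf_of_set)
  then show thesis
    using D that by blast
qed

lemma finite_set_pmf_graph_indices:
  fixes n N :: nat
  shows "0 < N \<Longrightarrow> finite (set_pmf (Pi_pmf {1..n} (0, 0) (\<lambda>_. pmf_of_set ({1..N} \<times> {1..N}))))"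
  by (intro finite_set_Pi_pmf) (auto simp: set_pmf_of_set)

lemma finite_set_pmf_graph_observations:
  fixes n N :: nat
  shows "finite (set_pmf (Pi_pmf ({1..n} \<times> {1..N} \<times> {1..N}) False
     (\<lambda>(k, i, j). bernoulli_pmf (edge_prob c \<Delta> N (X i * Y j)))))"
  by (intro finite_set_Pi_pmf) auto

lemma finite_set_graph_layer:
  "0 < N \<Longrightarrow> finite (set_pmf (graph_layer c \<Delta> N X Y n))"
  using finite_set_pmf_graph_indices[of N n] finite_set_pmf_graph_observations[of n N c \<Delta> X Y]
  by (simp add: graph_layer_def)

lemma expectation_graph_layer:
  fixes F :: "_ \<Rightarrow> real"
  assumes "0 < N"
  shows "measure_pmf.expectation (graph_layer c \<Delta> N X Y n) F =
    measure_pmf.expectation (Pi_pmf {1..n} (0, 0) (\<lambda>_. pmf_of_set ({1..N} \<times> {1..N}))) (\<lambda>ij.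
      measure_pmf.expectation (Pi_pmf ({1..n} \<times> {1..N} \<times> {1..N}) False
        (\<lambda>(k, i, j). bernoulli_pmf (edge_prob c \<Delta> N (X i * Y j)))) (\<lambda>G. F (n, ij, G)))"
  unfolding graph_layer_def
  using finite_set_pmf_graph_indices[OF assms, of n] finite_set_pmf_graph_observations[of n N c \<Delta> X Y]
  by (simp add: expectation_bind_pmf_finite)

text \<open>The mean of \<open>\<phi>\<close> over one term of the Hamiltonian, that is, over a
  uniform pair of indices and the observation attached to it.\<close>

definition edge_mean ::
  "real \<Rightarrow> real \<Rightarrow> nat \<Rightarrow> (nat \<Rightarrow> real) \<Rightarrow> (nat \<Rightarrow> real) \<Rightarrow> (nat \<times> nat \<Rightarrow> bool \<Rightarrow> real) \<Rightarrow> real" where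
  "edge_mean c \<Delta> N X Y \<phi> = (\<Sum>(i, j)\<in>{1..N} \<times> {1..N}.
     measure_pmf.expectation (bernoulli_pmf (edge_prob c \<Delta> N (X i * Y j))) (\<phi> (i, j))) / real N ^ 2"

lemma expectation_uniform_edge:
  fixes h :: "nat \<times> nat \<Rightarrow> real"
  assumes "0 < N"
  shows "measure_pmf.expectation (pmf_of_set ({1..N} \<times> {1..N})) h =
    (\<Sum>e\<in>{1..N} \<times> {1..N}. h e) / real N ^ 2"
  using assms by (subst integral_pmf_of_set) (auto simp: power2_eq_square)

text \<open>The label \<open>k\<close> separates the observations, so even a pair drawn twice comes
  with independent observations. Given the pairs, the expectation factorises over \<open>k\<close>,
  and the pairs are themselves independent.\<close>

lemma expectation_graph_layer_prod:
  fixes \<phi> :: "nat \<times> nat \<Rightarrow> bool \<Rightarrow> real"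
  assumes N: "0 < N" and \<phi>: "\<And>e b. 0 \<le> \<phi> e b"
  shows "measure_pmf.expectation (graph_layer c \<Delta> N X Y n)
      (\<lambda>(m, ij, G). \<Prod>k=1..m. \<phi> (ij k) (G (k, ij k))) = edge_mean c \<Delta> N X Y \<phi> ^ n"
proof -
  let ?E = "{1..N} \<times> {1..N}"
  let ?b = "\<lambda>(k::nat, i, j). bernoulli_pmf (edge_prob c \<Delta> N (X i * Y j))"
  let ?I = "Pi_pmf {1..n} (0, 0) (\<lambda>_. pmf_of_set ?E)"
  define h where "h = (\<lambda>e. measure_pmf.expectation (?b (0, e)) (\<phi> e))"
  have h: "0 \<le> h e" for e
    using \<phi> by (simp add: h_def integral_nonneg)
  have inner: "measure_pmf.expectation (Pi_pmf ({1..n} \<times> ?E) False ?b)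
      (\<lambda>G. \<Prod>k=1..n. \<phi> (ij k) (G (k, ij k))) = (\<Prod>k=1..n. h (ij k))"
    if "ij \<in> set_pmf ?I" for ij
  proof -
    have ij: "ij k \<in> ?E" if "k \<in> {1..n}" for k
      using \<open>ij \<in> set_pmf ?I\<close> that N by (auto simp: set_Pi_pmf PiE_dflt_def set_pmf_of_set)
    \<comment> \<open>Filling in the factor 1 at all other triples writes the product over
      \<open>k\<close> as a product over the whole index set of the independent
      observations.\<close>
    define \<psi> where "\<psi> = (\<lambda>(k, e) b. if e = ij k then \<phi> e b else 1)"
    have "(\<Prod>k=1..n. \<phi> (ij k) (G (k, ij k))) = (\<Prod>u\<in>{1..n} \<times> ?E. \<psi> u (G u))" for G
    proof -
      have "(\<Prod>u\<in>{1..n} \<times> ?E. \<psi> u (G u)) = (\<Prod>k=1..n. \<Prod>e\<in>?E. \<psi> (k, e) (G (k, e)))"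
        by (subst prod.cartesian_product) (simp add: split_beta)
      also have "\<dots> = (\<Prod>k=1..n. \<phi> (ij k) (G (k, ij k)))"
        using ij by (intro prod.cong refl) (simp add: \<psi>_def prod.delta)
      finally show ?thesis ..
    qed
    then have "measure_pmf.expectation (Pi_pmf ({1..n} \<times> ?E) False ?b)
        (\<lambda>G. \<Prod>k=1..n. \<phi> (ij k) (G (k, ij k))) =
      (\<Prod>u\<in>{1..n} \<times> ?E. measure_pmf.expectation (?b u) (\<psi> u))"
      using \<phi> by (simp only:)
        (subst expectation_prod_Pi_pmf, auto simp: \<psi>_def split_beta intro!: integrable_measure_pmf_finite)
    also have "\<dots> = (\<Prod>k=1..n. \<Prod>e\<in>?E. measure_pmf.expectation (?b (k, e)) (\<psi> (k, e)))"
      by (subst prod.cartesian_product) (simp add: split_beta)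
    also have "\<dots> = (\<Prod>k=1..n. \<Prod>e\<in>?E. if e = ij k then h e else 1)"
      by (intro prod.cong refl) (auto simp: \<psi>_def h_def split_beta)
    also have "\<dots> = (\<Prod>k=1..n. h (ij k))"
      using ij by (intro prod.cong refl) (simp add: prod.delta)
    finally show ?thesis .
  qed
  have "measure_pmf.expectation (graph_layer c \<Delta> N X Y n)
      (\<lambda>(m, ij, G). \<Prod>k=1..m. \<phi> (ij k) (G (k, ij k))) =
    measure_pmf.expectation ?I (\<lambda>ij. \<Prod>k=1..n. h (ij k))"
    using inner by (subst expectation_graph_layer[OF N]) (auto intro!: integral_cong_AE AE_pmfI)
  also have "\<dots> = (\<Prod>k=1..n. measure_pmf.expectation (pmf_of_set ?E) h)"
    using N h by (subst expectation_prod_Pi_pmf) (auto intro!: integrable_measure_pmf_finite simp: set_pmf_of_set)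
  also have "\<dots> = edge_mean c \<Delta> N X Y \<phi> ^ n"
    by (simp add: expectation_uniform_edge[OF N] edge_mean_def h_def split_beta del: One_nat_def)
  finally show ?thesis .
qed

text \<open>By linearity only the law of one pair and its observation matters. This is applied to
  the logarithm of the reference likelihood.\<close>

lemma expectation_graph_layer_sum:
  fixes \<phi> :: "nat \<times> nat \<Rightarrow> bool \<Rightarrow> real"
  assumes N: "0 < N"
  shows "measure_pmf.expectation (graph_layer c \<Delta> N X Y n)
      (\<lambda>(m, ij, G). \<Sum>k=1..m. \<phi> (ij k) (G (k, ij k))) = real n * edge_mean c \<Delta> N X Y \<phi>"
proof -
  let ?E = "{1..N} \<times> {1..N}"
  let ?b = "\<lambda>(k::nat, i, j). bernoulli_pmf (edge_prob c \<Delta> N (X i * Y j))"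
  let ?I = "Pi_pmf {1..n} (0, 0) (\<lambda>_. pmf_of_set ?E)"
  let ?G = "Pi_pmf ({1..n} \<times> ?E) False ?b"
  define h where "h = (\<lambda>e. measure_pmf.expectation (?b (0, e)) (\<phi> e))"
  have finI: "finite (set_pmf ?I)" and finG: "finite (set_pmf ?G)"
    by (rule finite_set_pmf_graph_indices[OF N], rule finite_set_pmf_graph_observations)
  have inner: "measure_pmf.expectation ?G (\<lambda>G. \<Sum>k=1..n. \<phi> (ij k) (G (k, ij k))) =
      (\<Sum>k=1..n. h (ij k))" if "ij \<in> set_pmf ?I" for ij
  proof -
    have ij: "ij k \<in> ?E" if "k \<in> {1..n}" for k
      using \<open>ij \<in> set_pmf ?I\<close> that N by (auto simp: set_Pi_pmf PiE_dflt_def set_pmf_of_set)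
    have "measure_pmf.expectation ?G (\<lambda>G. \<phi> (ij k) (G (k, ij k))) = h (ij k)" if "k \<in> {1..n}" for k
    proof -
      have "measure_pmf.expectation ?G (\<lambda>G. \<phi> (ij k) (G (k, ij k))) =
        measure_pmf.expectation (map_pmf (\<lambda>G. G (k, ij k)) ?G) (\<phi> (ij k))"
        by simp
      also have "map_pmf (\<lambda>G. G (k, ij k)) ?G = ?b (k, ij k)"
        using ij[OF that] that by (subst Pi_pmf_component) auto
      also have "measure_pmf.expectation (?b (k, ij k)) (\<phi> (ij k)) = h (ij k)"
        by (simp add: h_def split_beta)
      finally show ?thesis .
    qed
    then show ?thesis
      using finG by (subst Bochner_Integration.integral_sum) (auto intro!: integrable_measure_pmf_finite)
  qed
  have comp: "measure_pmf.expectation ?I (\<lambda>ij. h (ij k)) = edge_mean c \<Delta> N X Y \<phi>"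
    if "k \<in> {1..n}" for k
  proof -
    have "measure_pmf.expectation ?I (\<lambda>ij. h (ij k)) =
        measure_pmf.expectation (map_pmf (\<lambda>ij. ij k) ?I) h"
      by simp
    also have "map_pmf (\<lambda>ij. ij k) ?I = pmf_of_set ?E"
      using that by (subst Pi_pmf_component) auto
    finally show ?thesis
      by (simp add: expectation_uniform_edge[OF N] edge_mean_def h_def split_beta del: One_nat_def)
  qed
  have "measure_pmf.expectation (graph_layer c \<Delta> N X Y n)
      (\<lambda>(m, ij, G). \<Sum>k=1..m. \<phi> (ij k) (G (k, ij k))) =
    measure_pmf.expectation ?I (\<lambda>ij. \<Sum>k=1..n. h (ij k))"
    using inner by (subst expectation_graph_layer[OF N]) (auto intro!: integral_cong_AE AE_pmfI)
  also have "\<dots> = (\<Sum>k=1..n. edge_mean c \<Delta> N X Y \<phi>)"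
    using finI comp by (subst Bochner_Integration.integral_sum) (auto intro!: integrable_measure_pmf_finite)
  finally show ?thesis
    by simp
qed

section \<open>Upper bound for the free energy\<close>

text \<open>The signs \<open>x i\<close> leave the law of the symmetric spins unchanged, so the
  exponential moment is \<open>cosh \<theta> ^ N\<close>, and the sub-Gaussian bound applies to each
  factor.\<close>

lemma expectation_exp_spins_le:
  assumes x: "\<And>i. i \<in> {1..N} \<Longrightarrow> x i = -1 \<or> x i = 1"
  shows "measure_pmf.expectation (spins_pmf (1/2) N) (\<lambda>X. exp (\<theta> * (\<Sum>i=1..N. X i * x i)))
    \<le> exp (real N * \<theta>\<^sup>2 / 2)"
proof -
  have "measure_pmf.expectation (spins_pmf (1/2) N) (\<lambda>X. exp (\<theta> * (\<Sum>i=1..N. X i * x i))) =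
      measure_pmf.expectation (spins_pmf (1/2) N) (\<lambda>X. \<Prod>i=1..N. exp (\<theta> * (X i * x i)))"
    by (simp add: sum_distrib_left exp_sum)
  also have "\<dots> = (\<Prod>i=1..N. measure_pmf.expectation (spin_pmf (1/2)) (\<lambda>s. exp (\<theta> * (s * x i))))"
    unfolding spins_pmf_def
    by (subst expectation_prod_Pi_pmf) (auto intro!: integrable_measure_pmf_finite)
  also have "\<dots> = (\<Prod>i=1..N. cosh \<theta>)"
  proof (intro prod.cong refl)
    fix i assume "i \<in> {1..N}"
    from x[OF this] show
      "measure_pmf.expectation (spin_pmf (1/2)) (\<lambda>s. exp (\<theta> * (s * x i))) = cosh \<theta>"
      by (auto simp: expectation_spin_pmf cosh_field_def)
  qed
  also have "\<dots> \<le> (\<Prod>i=1..N. exp (\<theta>\<^sup>2 / 2))"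
    using cosh_le_exp_square by (intro prod_mono) (auto simp: cosh_real_nonneg)
  also have "\<dots> = exp (real N * \<theta>\<^sup>2 / 2)"
    by (simp flip: exp_of_nat_mult)
  finally show ?thesis .
qed

text \<open>This makes the signal-dependent part of the expected reference log-likelihood
  vanish.\<close>

lemma expectation_sum_symmetric_spins:
  "measure_pmf.expectation (spins_pmf (1/2) N) (\<lambda>X. \<Sum>i=1..N. X i) = 0"
proof -
  have "measure_pmf.expectation (spins_pmf (1/2) N) (\<lambda>X. X i) = 0" if "i \<in> {1..N}" for i
  proof -
    have "measure_pmf.expectation (spins_pmf (1/2) N) (\<lambda>X. X i) =
        measure_pmf.expectation (map_pmf (\<lambda>X. X i) (spins_pmf (1/2) N)) (\<lambda>s. s)"
      by simp
    also have "map_pmf (\<lambda>X. X i) (spins_pmf (1/2) N) = spin_pmf (1/2)"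
      using that unfolding spins_pmf_def by (subst Pi_pmf_component) auto
    finally show ?thesis
      by (simp add: expectation_spin_pmf)
  qed
  then show ?thesis
    by (subst Bochner_Integration.integral_sum) (auto intro!: integrable_measure_pmf_finite)
qed

section \<open>Likelihood of a single edge\<close>

lemma spin_product:
  assumes "X \<in> set_pmf (spins_pmf q N)" "Y \<in> set_pmf (spins_pmf q' N)" "i \<in> {1..N}" "j \<in> {1..N}"
  shows "X i * Y j = -1 \<or> X i * Y j = 1"
  using spins_pmfD[OF assms(1,3)] spins_pmfD[OF assms(2,4)] by auto

text \<open>Because of \<open>\<Delta> < c\<close>, the number \<open>c + \<Delta> * s\<close> lies
  strictly between 0 and \<open>2 * c\<close>.\<close>

lemma edge_prob_bounds:
  assumes "0 < \<Delta>" "\<Delta> < c" "2 * c \<le> real N" "s = -1 \<or> s = 1"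
  shows "0 < edge_prob c \<Delta> N s" "edge_prob c \<Delta> N s < 1"
  using assms by (auto simp: edge_prob_def field_simps)

text \<open>The value 0 of \<open>s\<close> is included for the sake of the reference
  likelihood.\<close>

lemma edge_weight_pos:
  assumes "0 < \<Delta>" "\<Delta> < c" "2 * c \<le> real N" "s = -1 \<or> s = 0 \<or> s = 1"
  shows "0 < edge_weight c \<Delta> N s b"
  using assms by (auto simp: edge_weight_def field_simps of_bool_def)

text \<open>In the mean of the likelihood ratio of one edge, the terms linear in
  \<open>X i * Y j\<close> and in \<open>x i * y j\<close> cancel between the two values of
  \<open>b\<close>; only the bilinear term survives. Summed over the indices it becomes a product of
  two overlaps.\<close>

lemma edge_mean_weight_ratio:
  assumes c: "0 < \<Delta>" "\<Delta> < c" "2 * c \<le> real N"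
    and X: "X \<in> set_pmf (spins_pmf q1 N)" and Y: "Y \<in> set_pmf (spins_pmf q2 N)"
    and x: "x \<in> set_pmf (spins_pmf q3 N)" and y: "y \<in> set_pmf (spins_pmf q4 N)"
  shows "edge_mean c \<Delta> N X Y (\<lambda>(i, j) b. edge_weight c \<Delta> N (x i * y j) b / edge_weight c \<Delta> N 0 b) =
    1 + \<Delta>\<^sup>2 / (c * (N - c)) * ((\<Sum>i=1..N. X i * x i) * (\<Sum>j=1..N. Y j * y j)) / real N ^ 2"
proof -
  have N: "0 < real N" "c < real N" using c by auto
  have edge: "measure_pmf.expectation (bernoulli_pmf (edge_prob c \<Delta> N (X i * Y j)))
      (\<lambda>b. edge_weight c \<Delta> N (x i * y j) b / edge_weight c \<Delta> N 0 b) =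
      1 + \<Delta>\<^sup>2 / (c * (N - c)) * ((X i * x i) * (Y j * y j))"
    if "i \<in> {1..N}" "j \<in> {1..N}" for i j
  proof -
    note S = edge_prob_bounds[OF c spin_product[OF X Y that]]
    have "measure_pmf.expectation (bernoulli_pmf (edge_prob c \<Delta> N (X i * Y j)))
      (\<lambda>b. edge_weight c \<Delta> N (x i * y j) b / edge_weight c \<Delta> N 0 b) =
      (c + \<Delta> * (X i * Y j)) / N * ((c + \<Delta> * (x i * y j)) / c) +
      (1 - (c + \<Delta> * (X i * Y j)) / N) * ((1 - (c + \<Delta> * (x i * y j)) / N) / (1 - c / N))"
      using S by (simp add: edge_prob_def edge_weight_def mult.commute)
    also have "\<dots> = 1 + \<Delta>\<^sup>2 / (c * (N - c)) * ((X i * x i) * (Y j * y j))"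
    proof -
      have "1 - c / N = (N - c) / N" using N by (simp add: field_simps)
      then show ?thesis
        using N c by (simp add: divide_simps) (simp add: algebra_simps power2_eq_square)
    qed
    finally show ?thesis .
  qed
  have "(\<Sum>(i, j)\<in>{1..N} \<times> {1..N}. 
      measure_pmf.expectation (bernoulli_pmf (edge_prob c \<Delta> N (X i * Y j)))
        (case (i, j) of (i, j) \<Rightarrow> \<lambda>b. edge_weight c \<Delta> N (x i * y j) b / edge_weight c \<Delta> N 0 b)) =
      (\<Sum>(i, j)\<in>{1..N} \<times> {1..N}. 1 + \<Delta>\<^sup>2 / (c * (N - c)) * ((X i * x i) * (Y j * y j)))"
    using edge by (intro sum.cong refl) auto
  also have "\<dots> = real N ^ 2 + \<Delta>\<^sup>2 / (c * (N - c)) * ((\<Sum>i=1..N. X i * x i) * (\<Sum>j=1..N. Y j * y j))"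
    unfolding sum_product
    by (simp add: sum.cartesian_product[symmetric] sum.distrib sum_distrib_left power2_eq_square)
  finally show ?thesis
    unfolding edge_mean_def using N by (simp add: add_divide_distrib)
qed

text \<open>The edge probability is affine in \<open>X i * Y j\<close> and the two logarithms are
  constants, so the mean is affine as well. Its linear part disappears once the symmetric spins are
  averaged.\<close>

lemma edge_mean_log_weight:
  assumes c: "0 < \<Delta>" "\<Delta> < c" "2 * c \<le> real N"
    and X: "X \<in> set_pmf (spins_pmf q1 N)" and Y: "Y \<in> set_pmf (spins_pmf q2 N)"
  shows "edge_mean c \<Delta> N X Y (\<lambda>_ b. ln (edge_weight c \<Delta> N 0 b)) =
    c / N * ln c + (1 - c / N) * ln (1 - c / N) +
    \<Delta> * (ln c - ln (1 - c / N)) / N ^ 3 * ((\<Sum>i=1..N. X i) * (\<Sum>j=1..N. Y j))"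
proof -
  have N: "0 < real N" "c < real N" using c by auto
  define a where "a = c / N * ln c + (1 - c / N) * ln (1 - c / N)"
  define d where "d = \<Delta> * (ln c - ln (1 - c / N)) / N"
  have edge: "measure_pmf.expectation (bernoulli_pmf (edge_prob c \<Delta> N (X i * Y j)))
      (\<lambda>b. ln (edge_weight c \<Delta> N 0 b)) =
a + d * (X i * Y j)"
    if "i \<in> {1..N}" "j \<in> {1..N}" for i j
  proof -
    note S = edge_prob_bounds[OF c spin_product[OF X Y that]]
    have "measure_pmf.expectation (bernoulli_pmf (edge_prob c \<Delta> N (X i * Y j)))
      (\<lambda>b. ln (edge_weight c \<Delta> N 0 b)) =
      (c + \<Delta> * (X i * Y j)) / N * ln c + (1 - (c + \<Delta> * (X i * Y j)) / N) * ln (1 - c / N)"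
      using S by (simp add: edge_prob_def edge_weight_def mult.commute)
    also have "\<dots> = a + d * (X i * Y j)"
      by (simp add: a_def d_def algebra_simps add_divide_distrib diff_divide_distrib)
    finally show ?thesis .
  qed
  have "(\<Sum>(i, j)\<in>{1..N} \<times> {1..N}. 
      measure_pmf.expectation (bernoulli_pmf (edge_prob c \<Delta> N (X i * Y j)))
        (\<lambda>b. ln (edge_weight c \<Delta> N 0 b))) =
      (\<Sum>(i, j)\<in>{1..N} \<times> {1..N}. a + d * (X i * Y j))"
    using edge by (intro sum.cong refl) auto
  also have "\<dots> = real N ^ 2 * a + d * ((\<Sum>i=1..N. X i) * (\<Sum>j=1..N. Y j))"
    unfolding sum_product
    by (simp add: sum.cartesian_product[symmetric] sum.distrib sum_distrib_left power2_eq_square)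
  finally show ?thesis
    unfolding edge_mean_def a_def[symmetric] using N
    by (simp add: add_divide_distrib d_def power2_eq_square power3_eq_cube)
qed

text \<open>The partition function at \<open>\<mu>1 = \<mu>2 = 0\<close>, where both point
  Hamiltonians vanish almost surely.\<close>

definition graph_partition ::
  "real \<Rightarrow> real \<Rightarrow> real \<Rightarrow> nat \<Rightarrow> nat \<times> (nat \<Rightarrow> nat \<times> nat) \<times> (nat \<times> nat \<times> nat \<Rightarrow> bool) \<Rightarrow> real" where
  "graph_partition c \<Delta> p N D =
    measure_pmf.expectation (pair_pmf (spins_pmf (1/2) N) (spins_pmf p N))
      (\<lambda>(x, y). exp (graph_hamiltonian c \<Delta> N D x y))"

text \<open>Growth at most linear in \<open>n\<close> makes the logarithm of the partition function
  integrable against the Poisson law. The constant is the same for all signals and replicas.\<close>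

lemma graph_hamiltonian_bound:
  assumes c: "0 < \<Delta>" "\<Delta> < c" "2 * c \<le> real N"
  obtains C where "0 \<le> C" "\<And>n D q1 q2 X Y q3 q4 x y. D \<in> set_pmf (graph_layer c \<Delta> N X Y n) \<Longrightarrow>
    x \<in> set_pmf (spins_pmf q3 N) \<Longrightarrow> y \<in> set_pmf (spins_pmf q4 N) \<Longrightarrow>
    \<bar>graph_hamiltonian c \<Delta> N D x y\<bar> \<le> C * real n"
proof
  define C where "C = (\<Sum>s\<in>{-1, 1}. \<Sum>b\<in>UNIV. \<bar>ln (edge_weight c \<Delta> N s b)\<bar>)"
  show "0 \<le> C" by (auto simp: C_def intro!: sum_nonneg)
  fix n D X Y q3 q4 x y
  assume D: "D \<in> set_pmf (graph_layer c \<Delta> N X Y n)"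
    and x: "x \<in> set_pmf (spins_pmf q3 N)" and y: "y \<in> set_pmf (spins_pmf q4 N)"
  have N: "0 < N" using c by (cases N) auto
  from D N obtain ij G where D: "D = (n, ij, G)" and ij: "\<And>k. k \<in> {1..n} \<Longrightarrow> ij k \<in> {1..N} \<times> {1..N}"
    by (rule set_graph_layerE) blast
  have w: "\<bar>ln (edge_weight c \<Delta> N s b)\<bar> \<le> C" if "s \<in> {-1, 1}" for s b
  proof -
    have "\<bar>ln (edge_weight c \<Delta> N s b)\<bar> \<le> (\<Sum>b\<in>UNIV. \<bar>ln (edge_weight c \<Delta> N s b)\<bar>)"
      by (rule member_le_sum) auto
    also have "\<dots> \<le> C"
      unfolding C_def using that
      by (intro member_le_sum[where f="\<lambda>s. \<Sum>b\<in>UNIV. \<bar>ln (edge_weight c \<Delta> N s b)\<bar>"])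
        (auto intro!: sum_nonneg)
    finally show ?thesis .
  qed
  have "\<bar>graph_hamiltonian c \<Delta> N D x y\<bar> \<le>
    (\<Sum>k=1..n. \<bar>case ij k of (i, j) \<Rightarrow> ln (edge_weight c \<Delta> N (x i * y j) (G (k, i, j)))\<bar>)"
    by (simp add: D graph_hamiltonian_def)
  also have "\<dots> \<le> (\<Sum>k=1..n. C)"
  proof (rule sum_mono)
    fix k assume "k \<in> {1..n}"
    then show "\<bar>case ij k of (i, j) \<Rightarrow> ln (edge_weight c \<Delta> N (x i * y j) (G (k, i, j)))\<bar> \<le> C"
      using ij[of k] spin_product[OF x y, of "fst (ij k)" "snd (ij k)"]
      by (auto simp: split_beta intro!: w)
  qed
  finally show "\<bar>graph_hamiltonian c \<Delta> N D x y\<bar> \<le> C * real n"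
    by (simp add: mult.commute)
qed

lemma exp_graph_hamiltonian:
  assumes c: "0 < \<Delta>" "\<Delta> < c" "2 * c \<le> real N"
    and x: "x \<in> set_pmf (spins_pmf q3 N)" and y: "y \<in> set_pmf (spins_pmf q4 N)"
    and ij: "\<And>k. k \<in> {1..n} \<Longrightarrow> ij k \<in> {1..N} \<times> {1..N}"
  shows "exp (graph_hamiltonian c \<Delta> N (n, ij, G) x y) =
    (\<Prod>k=1..n. edge_weight c \<Delta> N (x (fst (ij k)) * y (snd (ij k))) (G (k, ij k)))"
proof -
  have "exp (graph_hamiltonian c \<Delta> N (n, ij, G) x y) =
    (\<Prod>k=1..n. exp (ln (edge_weight c \<Delta> N (x (fst (ij k)) * y (snd (ij k))) (G (k, ij k)))))"
    by (simp add: graph_hamiltonian_def exp_sum split_beta)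
  also have "\<dots> = (\<Prod>k=1..n. edge_weight c \<Delta> N (x (fst (ij k)) * y (snd (ij k))) (G (k, ij k)))"
  proof (intro prod.cong refl exp_ln edge_weight_pos[OF c])
    fix k assume "k \<in> {1..n}"
    then show "x (fst (ij k)) * y (snd (ij k)) = -1 \<or> x (fst (ij k)) * y (snd (ij k)) = 0 \<or>
        x (fst (ij k)) * y (snd (ij k)) = 1"
      using ij[of k] spin_product[OF x y, of "fst (ij k)" "snd (ij k)"] by auto
  qed
  finally show ?thesis .
qed

text \<open>Jensen's inequality in the form of the tangent to the logarithm at a level
  \<open>A\<close> that is common to all signals, so that \<open>A\<close> can later be set to a
  bound for a mean over the signal. The quotient by the reference likelihood is averaged explicitly,
  over the edges first and then over their Poisson number.\<close>

lemma expectation_ln_graph_partition_le: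
  fixes t A :: real
  assumes c: "0 < \<Delta>" "\<Delta> < c" "2 * c \<le> real N" and t: "0 < t" and A: "0 < A"
    and X: "X \<in> set_pmf (spins_pmf (1/2) N)" and Y: "Y \<in> set_pmf (spins_pmf p N)"
  shows "measure_pmf.expectation (graph_data c \<Delta> N t X Y) (\<lambda>D. ln (graph_partition c \<Delta> p N D)) \<le>
    t * real N ^ 2 * edge_mean c \<Delta> N X Y (\<lambda>_ b. ln (edge_weight c \<Delta> N 0 b)) + (ln A - 1) +
    measure_pmf.expectation (pair_pmf (spins_pmf (1/2) N) (spins_pmf p N)) (\<lambda>(x, y).
      exp (t * (\<Delta>\<^sup>2 / (c * (N - c))) * ((\<Sum>i=1..N. X i * x i) * (\<Sum>j=1..N. Y j * y j)))) / A"
proof -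
  have N: "0 < N" "0 < real N" "c < real N" using c by auto
  let ?P = "pair_pmf (spins_pmf (1/2) N) (spins_pmf p N)"
  let ?r = "t * real N ^ 2"
  let ?L = "graph_layer c \<Delta> N X Y"
  let ?E = "measure_pmf.expectation (graph_data c \<Delta> N t X Y) (\<lambda>D. ln (graph_partition c \<Delta> p N D))"
  define \<rho> where "\<rho> = edge_mean c \<Delta> N X Y (\<lambda>_ b. ln (edge_weight c \<Delta> N 0 b))"
  \<comment> \<open>\<open>u\<close> is the product of the overlaps of signal and replica,
    \<open>q\<close> the mean likelihood ratio of one edge, and \<open>R\<close> the logarithm of
    the reference likelihood.\<close>
  define u where "u = (\<lambda>(x, y). (\<Sum>i=1..N. X i * x i) * (\<Sum>j=1..N. Y j * y j))"
  define q where "q = (\<lambda>z. 1 + \<Delta>\<^sup>2 / (c * (N - c)) * u z / real N ^ 2)"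
  define R where "R = (\<lambda>(m::nat, ij::nat \<Rightarrow> nat \<times> nat, G). \<Sum>k=1..m. ln (edge_weight c \<Delta> N 0 (G (k, ij k))))"
  have r: "0 < ?r" using t N by simp
  obtain C where C: "0 \<le> C" "\<And>n D x y. D \<in> set_pmf (?L n) \<Longrightarrow>
    x \<in> set_pmf (spins_pmf (1/2) N) \<Longrightarrow> y \<in> set_pmf (spins_pmf p N) \<Longrightarrow>
    \<bar>graph_hamiltonian c \<Delta> N D x y\<bar> \<le> C * real n"
    using graph_hamiltonian_bound[OF c] by metis
  have Z: "exp (- (C * real n)) \<le> graph_partition c \<Delta> p N D" "graph_partition c \<Delta> p N D \<le> exp (C * real n)"
    if "D \<in> set_pmf (?L n)" for n D
  proof -
    have H: "- (C * real n) \<le> graph_hamiltonian c \<Delta> N D (fst z) (snd z)"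
      "graph_hamiltonian c \<Delta> N D (fst z) (snd z) \<le> C * real n" if "z \<in> set_pmf ?P" for z
      using C(2)[OF \<open>D \<in> set_pmf (?L n)\<close>, of "fst z" "snd z"] that by (auto simp: abs_le_iff)
    show "graph_partition c \<Delta> p N D \<le> exp (C * real n)"
      unfolding graph_partition_def by (rule expectation_pmf_le_const) (use H in auto)
    show "exp (- (C * real n)) \<le> graph_partition c \<Delta> p N D"
      using expectation_pmf_mono[of ?P "\<lambda>_. exp (- (C * real n))" "\<lambda>(x, y). exp (graph_hamiltonian c \<Delta> N D x y)"] H
      unfolding graph_partition_def by auto
  qed
  have Zpos: "0 < graph_partition c \<Delta> p N D" if "D \<in> set_pmf (?L n)" for n D
    using Z(1)[OF that] exp_gt_zero less_le_trans by blast
  have lnZ: "\<bar>ln (graph_partition c \<Delta> p N D)\<bar> \<le> C * real n" if "D \<in> set_pmf (?L n)" for n D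
  proof -
    have "ln (exp (- (C * real n))) \<le> ln (graph_partition c \<Delta> p N D)"
      "ln (graph_partition c \<Delta> p N D) \<le> ln (exp (C * real n))"
      using Z[OF that] Zpos[OF that] by (auto simp only: ln_le_cancel_iff exp_gt_zero)
    then show ?thesis by (simp add: abs_le_iff)
  qed
  have finL: "finite (set_pmf (?L n))" for n
    by (rule finite_set_graph_layer[OF N(1)])
  have intn: "integrable (measure_pmf (poisson_pmf ?r)) (\<lambda>n. C * real n)"
    using poisson_pmf_mean(1)[OF r] by simp
  \<comment> \<open>Conditioning on the number of edges; the domination is supplied by
    \<open>lnZ\<close>.\<close>
  have E: "?E = measure_pmf.expectation (poisson_pmf ?r)
      (\<lambda>n. measure_pmf.expectation (?L n) (\<lambda>D. ln (graph_partition c \<Delta> p N D)))"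
    using t N unfolding graph_data_eq_bind poisson_law_def
    by (simp add: expectation_bind_pmf_dominated(2)[OF lnZ intn])
  have layer: "measure_pmf.expectation (?L n) (\<lambda>D. ln (graph_partition c \<Delta> p N D)) \<le>
      real n * \<rho> + (ln A - 1) + measure_pmf.expectation ?P (\<lambda>z. q z ^ n) / A" for n
  proof -
    have ratio: "graph_partition c \<Delta> p N D / exp (R D) = measure_pmf.expectation ?P (\<lambda>(x, y).
        case D of (m, ij, G) \<Rightarrow> \<Prod>k=1..m. edge_weight c \<Delta> N (x (fst (ij k)) * y (snd (ij k))) (G (k, ij k)) /
          edge_weight c \<Delta> N 0 (G (k, ij k)))" if "D \<in> set_pmf (?L n)" for D
    proof -
      from that N(1) obtain ij G where D: "D = (n, ij, G)"
        and ij: "\<And>k. k \<in> {1..n} \<Longrightarrow> ij k \<in> {1..N} \<times> {1..N}"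
        by (rule set_graph_layerE) blast
      have "exp (R D) = (\<Prod>k=1..n. edge_weight c \<Delta> N 0 (G (k, ij k)))"
        using edge_weight_pos[OF c, of 0] by (simp add: D R_def exp_sum)
      then have "graph_partition c \<Delta> p N D / exp (R D) = measure_pmf.expectation ?P
          (\<lambda>(x, y). exp (graph_hamiltonian c \<Delta> N D x y) / (\<Prod>k=1..n. edge_weight c \<Delta> N 0 (G (k, ij k))))"
        unfolding graph_partition_def by (simp add: case_prod_unfold)
      also have "\<dots> = measure_pmf.expectation ?P (\<lambda>(x, y).
        case D of (m, ij, G) \<Rightarrow> \<Prod>k=1..m. edge_weight c \<Delta> N (x (fst (ij k)) * y (snd (ij k))) (G (k, ij k)) /
          edge_weight c \<Delta> N 0 (G (k, ij k)))"
        using exp_graph_hamiltonian[OF c _ _ ij]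
        by (intro integral_cong_AE AE_pmfI) (auto simp: D prod_dividef)
      finally show ?thesis .
    qed
    have "measure_pmf.expectation (?L n) (\<lambda>D. ln (graph_partition c \<Delta> p N D)) \<le>
      measure_pmf.expectation (?L n) (\<lambda>D. R D + (ln A - 1) + (graph_partition c \<Delta> p N D / exp (R D)) / A)"
    proof (rule expectation_pmf_mono[OF finL])
      fix D assume "D \<in> set_pmf (?L n)"
      note W = Zpos[OF this]
      have "ln (graph_partition c \<Delta> p N D / exp (R D) / A) \<le> graph_partition c \<Delta> p N D / exp (R D) / A - 1"
        by (rule ln_le_minus_one) (use W A in auto)
      moreover have "ln (graph_partition c \<Delta> p N D / exp (R D) / A) = ln (graph_partition c \<Delta> p N D) - R D - ln A"
        using W A by (simp add: ln_div ln_mult)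
      ultimately show "ln (graph_partition c \<Delta> p N D) \<le>
          R D + (ln A - 1) + (graph_partition c \<Delta> p N D / exp (R D)) / A"
        by simp
    qed
    also have "\<dots> = measure_pmf.expectation (?L n) R + (ln A - 1) +
        measure_pmf.expectation (?L n) (\<lambda>D. graph_partition c \<Delta> p N D / exp (R D)) / A"
      using finL by (simp add: integrable_measure_pmf_finite del: divide_divide_eq_left)
    also have "measure_pmf.expectation (?L n) R = real n * \<rho>"
      unfolding R_def \<rho>_def using expectation_graph_layer_sum[OF N(1), of c \<Delta> X Y n "\<lambda>_ b. ln (edge_weight c \<Delta> N 0 b)"] .
    also have "measure_pmf.expectation (?L n) (\<lambda>D. graph_partition c \<Delta> p N D / exp (R D)) =
      measure_pmf.expectation (?L n) (\<lambda>D. measure_pmf.expectation ?P (\<lambda>z.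
        case D of (m, ij, G) \<Rightarrow> \<Prod>k=1..m. edge_weight c \<Delta> N (fst z (fst (ij k)) * snd z (snd (ij k))) (G (k, ij k)) /
          edge_weight c \<Delta> N 0 (G (k, ij k))))"
      by (intro integral_cong_AE AE_pmfI) (auto simp: ratio case_prod_unfold)
    \<comment> \<open>With the replica fixed, the expectation over the data is that of a product
      over independent edges.\<close>
    also have "\<dots> = measure_pmf.expectation ?P (\<lambda>z. measure_pmf.expectation (?L n) (\<lambda>D.
        case D of (m, ij, G) \<Rightarrow> \<Prod>k=1..m. edge_weight c \<Delta> N (fst z (fst (ij k)) * snd z (snd (ij k))) (G (k, ij k)) /
          edge_weight c \<Delta> N 0 (G (k, ij k))))"
      using finL by (rule expectation_swap_finite) simp
    also have "\<dots> = measure_pmf.expectation ?P (\<lambda>z. q z ^ n)"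
    proof (intro integral_cong_AE AE_pmfI)
      fix z assume "z \<in> set_pmf ?P"
      then have z: "fst z \<in> set_pmf (spins_pmf (1/2) N)" "snd z \<in> set_pmf (spins_pmf p N)" by auto
      \<comment> \<open>The value 0 outside the index square secures nonnegativity for all
        arguments, since the replica's products are known to be signs only inside it.\<close>
      define \<phi> where "\<phi> = (\<lambda>e b. if e \<in> {1..N} \<times> {1..N} then
        edge_weight c \<Delta> N (fst z (fst e) * snd z (snd e)) b / edge_weight c \<Delta> N 0 b else 0)"
      have \<phi>: "0 \<le> \<phi> e b" for e b
      proof (cases "e \<in> {1..N} \<times> {1..N}")
        case True
        then have "0 < edge_weight c \<Delta> N (fst z (fst e) * snd z (snd e)) b"
          using spin_product[OF z, of "fst e" "snd e"] by (intro edge_weight_pos[OF c]) auto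
        then show ?thesis
          using edge_weight_pos[OF c, of 0 b] by (auto simp: \<phi>_def less_imp_le)
      qed (auto simp: \<phi>_def)
      have "measure_pmf.expectation (?L n) (\<lambda>D. case D of (m, ij, G) \<Rightarrow>
          \<Prod>k=1..m. edge_weight c \<Delta> N (fst z (fst (ij k)) * snd z (snd (ij k))) (G (k, ij k)) /
          edge_weight c \<Delta> N 0 (G (k, ij k))) =
        measure_pmf.expectation (?L n) (\<lambda>(m, ij, G). \<Prod>k=1..m. \<phi> (ij k) (G (k, ij k)))"
      proof (intro integral_cong_AE AE_pmfI)
        fix D assume "D \<in> set_pmf (?L n)"
        from this N(1) obtain ij G where D: "D = (n, ij, G)"
          and ij: "\<And>k. k \<in> {1..n} \<Longrightarrow> ij k \<in> {1..N} \<times> {1..N}"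
          by (rule set_graph_layerE) blast
        show "(case D of (m, ij, G) \<Rightarrow>
          \<Prod>k=1..m. edge_weight c \<Delta> N (fst z (fst (ij k)) * snd z (snd (ij k))) (G (k, ij k)) /
          edge_weight c \<Delta> N 0 (G (k, ij k))) = (case D of (m, ij, G) \<Rightarrow> \<Prod>k=1..m. \<phi> (ij k) (G (k, ij k)))"
          unfolding D prod.case by (intro prod.cong refl) (use ij in \<open>simp add: \<phi>_def\<close>)
      qed auto
      also have "\<dots> = edge_mean c \<Delta> N X Y \<phi> ^ n"
        by (rule expectation_graph_layer_prod[OF N(1) \<phi>])
      also have "edge_mean c \<Delta> N X Y \<phi> = edge_mean c \<Delta> N X Y
          (\<lambda>(i, j) b. edge_weight c \<Delta> N (fst z i * snd z j) b / edge_weight c \<Delta> N 0 b)"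
        unfolding edge_mean_def by (intro arg_cong2[where f="(/)"] sum.cong refl) (auto simp: \<phi>_def)
      also have "\<dots> = q z"
        by (subst edge_mean_weight_ratio[OF c X Y z]) (simp add: q_def u_def split_beta)
      finally show "measure_pmf.expectation (?L n) (\<lambda>D. case D of (m, ij, G) \<Rightarrow>
          \<Prod>k=1..m. edge_weight c \<Delta> N (fst z (fst (ij k)) * snd z (snd (ij k))) (G (k, ij k)) /
          edge_weight c \<Delta> N 0 (G (k, ij k))) = q z ^ n" .
    qed auto
    finally show ?thesis .
  qed
  have sumP: "measure_pmf.expectation ?P h = (\<Sum>z\<in>set_pmf ?P. pmf ?P z * h z)" for h :: "_ \<Rightarrow> real"
    by (subst integral_measure_pmf[of "set_pmf ?P"]) auto
  have intq: "integrable (measure_pmf (poisson_pmf ?r)) (\<lambda>n. measure_pmf.expectation ?P (\<lambda>z. q z ^ n))"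
    unfolding sumP using poisson_pmf_power(1)[OF r]
    by (intro Bochner_Integration.integrable_sum integrable_mult_right) auto
  \<comment> \<open>The generating function applies for each replica. In the exponent
    \<open>?r * (q z - 1)\<close> the factor \<open>N ^ 2\<close> of the rate cancels the one in
    \<open>q\<close>.\<close>
  have Eq: "measure_pmf.expectation (poisson_pmf ?r) (\<lambda>n. measure_pmf.expectation ?P (\<lambda>z. q z ^ n)) =
      measure_pmf.expectation ?P (\<lambda>z. exp (?r * (q z - 1)))"
    unfolding sumP using poisson_pmf_power[OF r] by (subst Bochner_Integration.integral_sum) auto
  have intE: "integrable (measure_pmf (poisson_pmf ?r))
      (\<lambda>n. measure_pmf.expectation (?L n) (\<lambda>D. ln (graph_partition c \<Delta> p N D)))"
  proof (rule Bochner_Integration.integrable_bound[OF intn])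
    show "AE n in poisson_pmf ?r. norm (measure_pmf.expectation (?L n) (\<lambda>D. ln (graph_partition c \<Delta> p N D)))
        \<le> norm (C * real n)"
    proof (rule AE_pmfI)
      fix n
      have "measure_pmf.expectation (?L n) (\<lambda>D. ln (graph_partition c \<Delta> p N D)) \<le> C * real n"
        by (rule expectation_pmf_le_const[OF finL]) (use lnZ in \<open>auto simp: abs_le_iff\<close>)
      moreover have "measure_pmf.expectation (?L n) (\<lambda>D. - ln (graph_partition c \<Delta> p N D)) \<le> C * real n"
        by (rule expectation_pmf_le_const[OF finL]) (use lnZ in \<open>auto simp: abs_le_iff\<close>)
      ultimately show "norm (measure_pmf.expectation (?L n) (\<lambda>D. ln (graph_partition c \<Delta> p N D)))
          \<le> norm (C * real n)"
        using C(1) by (simp add: abs_le_iff)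
    qed
  qed auto
  have "?E \<le> measure_pmf.expectation (poisson_pmf ?r)
      (\<lambda>n. real n * \<rho> + (ln A - 1) + measure_pmf.expectation ?P (\<lambda>z. q z ^ n) / A)"
    unfolding E using intE intq poisson_pmf_mean[OF r] layer by (intro integral_mono) auto
  also have "\<dots> = ?r * \<rho> + (ln A - 1) + measure_pmf.expectation ?P (\<lambda>z. exp (?r * (q z - 1))) / A"
    using intq poisson_pmf_mean[OF r] by (simp add: Eq)
  also have "measure_pmf.expectation ?P (\<lambda>z. exp (?r * (q z - 1))) =
     measure_pmf.expectation ?P (\<lambda>(x, y).
      exp (t * (\<Delta>\<^sup>2 / (c * (N - c))) * ((\<Sum>i=1..N. X i * x i) * (\<Sum>j=1..N. Y j * y j))))"
    using N by (intro Bochner_Integration.integral_cong) (auto simp: q_def u_def)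
  finally show ?thesis
    by (simp add: \<rho>_def)
qed

section \<open>Averaging over the signal and the replicas\<close>

lemma abs_sum_spins_le:
  assumes "Y \<in> set_pmf (spins_pmf q N)" "y \<in> set_pmf (spins_pmf q' N)"
  shows "\<bar>\<Sum>j=1..N. Y j * y j\<bar> \<le> real N"
proof -
  have "\<bar>\<Sum>j=1..N. Y j * y j\<bar> \<le> (\<Sum>j=1..N. 1)"
    using spins_pmfD[OF assms(1)] spins_pmfD[OF assms(2)]
    by (intro order_trans[OF sum_abs] sum_mono) fastforce
  then show ?thesis by simp
qed

text \<open>The symmetric spins \<open>X\<close> are averaged first, with \<open>x\<close>,
  \<open>y\<close> and \<open>Y\<close> fixed. The exponent is then linear in \<open>X\<close> with
  parameter \<open>s * V\<close>, where the overlap \<open>V\<close> of \<open>Y\<close> and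
  \<open>y\<close> is at most \<open>N\<close> in absolute value.\<close>

lemma expectation_exp_overlap_le:
  fixes s :: real
  shows "measure_pmf.expectation (pair_pmf (spins_pmf (1/2) N) (spins_pmf p N)) (\<lambda>(X, Y).
    measure_pmf.expectation (pair_pmf (spins_pmf (1/2) N) (spins_pmf p N)) (\<lambda>(x, y).
      exp (s * ((\<Sum>i=1..N. X i * x i) * (\<Sum>j=1..N. Y j * y j))))) \<le> exp (real N * (s * real N)\<^sup>2 / 2)"
    (is "?lhs \<le> ?A")
proof -
  let ?P = "pair_pmf (spins_pmf (1/2) N) (spins_pmf p N)"
  have le: "measure_pmf.expectation (spins_pmf (1/2) N) (\<lambda>X.
      exp (s * ((\<Sum>i=1..N. X i * x i) * (\<Sum>j=1..N. Y j * y j)))) \<le> ?A"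
    if x: "x \<in> set_pmf (spins_pmf (1/2) N)" and y: "y \<in> set_pmf (spins_pmf p N)"
      and Y: "Y \<in> set_pmf (spins_pmf p N)" for x y Y
  proof -
    define V where "V = (\<Sum>j=1..N. Y j * y j)"
    have "measure_pmf.expectation (spins_pmf (1/2) N) (\<lambda>X. exp (s * ((\<Sum>i=1..N. X i * x i) * V))) =
      measure_pmf.expectation (spins_pmf (1/2) N) (\<lambda>X. exp (s * V * (\<Sum>i=1..N. X i * x i)))"
      by (simp add: mult_ac)
    also have "\<dots> \<le> exp (real N * (s * V)\<^sup>2 / 2)"
      using spins_pmfD[OF x] by (rule expectation_exp_spins_le)
    also have "\<dots> \<le> ?A"
    proof -
      have "V\<^sup>2 \<le> (real N)\<^sup>2"
        using abs_sum_spins_le[OF Y y] unfolding V_def[symmetric] by (simp add: abs_le_square_iff[symmetric])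
      then show ?thesis
        by (simp add: power_mult_distrib mult_left_mono divide_right_mono)
    qed
    finally show ?thesis unfolding V_def .
  qed
  have "?lhs = measure_pmf.expectation ?P (\<lambda>z. measure_pmf.expectation ?P (\<lambda>w.
      exp (s * ((\<Sum>i=1..N. fst w i * fst z i) * (\<Sum>j=1..N. snd w j * snd z j)))))"
    unfolding split_beta by (rule expectation_swap_finite) auto
  also have "\<dots> \<le> ?A"
  proof (rule expectation_pmf_le_const)
    fix z assume z: "z \<in> set_pmf ?P"
    have "measure_pmf.expectation ?P (\<lambda>w. exp (s * ((\<Sum>i=1..N. fst w i * fst z i) * (\<Sum>j=1..N. snd w j * snd z j)))) =
      measure_pmf.expectation (spins_pmf p N) (\<lambda>Y. measure_pmf.expectation (spins_pmf (1/2) N) (\<lambda>X.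
        exp (s * ((\<Sum>i=1..N. X i * fst z i) * (\<Sum>j=1..N. Y j * snd z j)))))"
      by (simp add: expectation_pair_pmf_finite) (rule expectation_swap_finite; simp)
    also have "\<dots> \<le> ?A"
      using z by (intro expectation_pmf_le_const le) auto
    finally show "measure_pmf.expectation ?P (\<lambda>w.
      exp (s * ((\<Sum>i=1..N. fst w i * fst z i) * (\<Sum>j=1..N. snd w j * snd z j)))) \<le> ?A" .
  qed auto
  finally show ?thesis .
qed

text \<open>\<open>A\<close> is chosen as the bound for the averaged exponential of the overlaps.
  The tangent terms then add up to at most \<open>ln A\<close>, which is of order
  \<open>N * t\<^sup>2\<close>.\<close>

lemma graph_free_energy_le:
  fixes t :: real
  assumes c: "0 < \<Delta>" "\<Delta> < c" "2 * c \<le> real N" and t: "0 < t"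
  shows "1 / real N * measure_pmf.expectation (pair_pmf (spins_pmf (1/2) N) (spins_pmf p N)) (\<lambda>(X, Y).
      measure_pmf.expectation (graph_data c \<Delta> N t X Y) (\<lambda>D. ln (graph_partition c \<Delta> p N D)))
    \<le> t * g_fun c \<Delta> 0 + t * c\<^sup>2 / real N + 2 * (t * \<Delta>\<^sup>2 / c)\<^sup>2"
    (is "1 / real N * ?E \<le> _")
proof -
  have N: "0 < N" "0 < real N" "c < real N" "0 < c" using c by auto
  let ?P = "pair_pmf (spins_pmf (1/2) N) (spins_pmf p N)"
  define s where "s = t * (\<Delta>\<^sup>2 / (c * (N - c)))"
  define A where "A = exp (real N * (s * real N)\<^sup>2 / 2)"
  define a where "a = c / N * ln c + (1 - c / N) * ln (1 - c / N)"
  define d where "d = \<Delta> * (ln c - ln (1 - c / N)) / N ^ 3"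
  have fin: "finite (set_pmf ?P)" by simp
  \<comment> \<open>\<open>X\<close> is centred and independent of \<open>Y\<close>.\<close>
  have zero: "measure_pmf.expectation ?P (\<lambda>z. (\<Sum>i=1..N. fst z i) * (\<Sum>j=1..N. snd z j)) = 0"
    using expectation_sum_symmetric_spins[of N] by (simp add: expectation_pair_pmf_finite)
  have "?E \<le> measure_pmf.expectation ?P (\<lambda>z. t * real N ^ 2 *
      (a + d * ((\<Sum>i=1..N. fst z i) * (\<Sum>j=1..N. snd z j))) + (ln A - 1) +
      measure_pmf.expectation ?P (\<lambda>(x, y).
        exp (s * ((\<Sum>i=1..N. fst z i * x i) * (\<Sum>j=1..N. snd z j * y j)))) / A)"
  proof (rule expectation_pmf_mono[OF fin])
    fix z assume "z \<in> set_pmf ?P"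
    then have z: "fst z \<in> set_pmf (spins_pmf (1/2) N)" "snd z \<in> set_pmf (spins_pmf p N)" by auto
    show "(case z of (X, Y) \<Rightarrow>
      measure_pmf.expectation (graph_data c \<Delta> N t X Y) (\<lambda>D. ln (graph_partition c \<Delta> p N D))) \<le>
      t * real N ^ 2 * (a + d * ((\<Sum>i=1..N. fst z i) * (\<Sum>j=1..N. snd z j))) + (ln A - 1) +
      measure_pmf.expectation ?P (\<lambda>(x, y).
        exp (s * ((\<Sum>i=1..N. fst z i * x i) * (\<Sum>j=1..N. snd z j * y j)))) / A"
      using expectation_ln_graph_partition_le[OF c t _ z, of A] edge_mean_log_weight[OF c z]
      by (simp add: split_beta a_def d_def s_def A_def)
  qed
  also have "\<dots> = t * real N ^ 2 * a + (ln A - 1) + measure_pmf.expectation ?P (\<lambda>z.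
      measure_pmf.expectation ?P (\<lambda>(x, y).
        exp (s * ((\<Sum>i=1..N. fst z i * x i) * (\<Sum>j=1..N. snd z j * y j))))) / A"
    using fin zero by (simp add: integrable_measure_pmf_finite distrib_left)
  also have "measure_pmf.expectation ?P (\<lambda>z. measure_pmf.expectation ?P (\<lambda>(x, y).
        exp (s * ((\<Sum>i=1..N. fst z i * x i) * (\<Sum>j=1..N. snd z j * y j))))) \<le> A"
    using expectation_exp_overlap_le[of N p s] by (simp add: case_prod_unfold A_def)
  \<comment> \<open>Here the choice of \<open>A\<close> enters:
    \<open>(ln A - 1) + A / A = ln A\<close>.\<close>
  finally have E: "?E \<le> t * real N ^ 2 * a + ln A"
    by (simp add: A_def divide_right_mono)
  have "1 / real N * ?E \<le> 1 / real N * (t * real N ^ 2 * a + ln A)"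
    using E N by (intro mult_left_mono) auto
  also have "\<dots> = t * (real N * a) + (s * real N)\<^sup>2 / 2"
    using N by (simp add: A_def field_simps power2_eq_square)
  also have "\<dots> \<le> t * (c * (ln c - 1) + c\<^sup>2 / real N) + (2 * (t * \<Delta>\<^sup>2 / c))\<^sup>2 / 2"
  proof (intro add_mono mult_left_mono divide_right_mono power_mono)
    \<comment> \<open>The bound \<open>ln (1 - u) \<le> - u\<close> at \<open>u = c / N\<close>
      leaves the error \<open>c\<^sup>2 / real N\<close>.\<close>
    have "(1 - c / N) * ln (1 - c / N) \<le> (1 - c / N) * (- (c / N))"
      using N ln_le_minus_one[of "1 - c / N"] by (intro mult_left_mono) (auto simp: field_simps)
    then have "real N * a \<le> real N * (c / N * ln c + (1 - c / N) * (- (c / N)))"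
      using N by (simp add: a_def)
    also have "\<dots> = c * (ln c - 1) + c\<^sup>2 / real N"
      using N by (simp add: field_simps power2_eq_square)
    finally show "real N * a \<le> c * (ln c - 1) + c\<^sup>2 / real N" .
    \<comment> \<open>From \<open>2 * c \<le> real N\<close>; this is the source of the factor 2 in
      the bound for \<open>s * real N\<close>.\<close>
    have "real N / (N - c) \<le> 2"
      using c N by (simp add: field_simps)
    then have "(t * \<Delta>\<^sup>2 / c) * (real N / (N - c)) \<le> (t * \<Delta>\<^sup>2 / c) * 2"
      using t N by (intro mult_left_mono) auto
    then show "s * real N \<le> 2 * (t * \<Delta>\<^sup>2 / c)"
      by (simp add: s_def mult_ac)
    show "0 \<le> s * real N"
      using t N by (simp add: s_def)
  qed (use t in auto)
  also have "\<dots> = t * g_fun c \<Delta> 0 + t * c\<^sup>2 / real N + 2 * (t * \<Delta>\<^sup>2 / c)\<^sup>2"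
  proof -
    have "(2 * u)\<^sup>2 / 2 = 2 * u\<^sup>2" for u :: real
      by (simp add: power_mult_distrib)
    then show ?thesis
      by (simp only:) (simp add: g_fun_def algebra_simps)
  qed
  finally show ?thesis .
qed

section \<open>Vanishing point processes\<close>

text \<open>\<open>M1\<close> is the image of the product under \<open>fst\<close>, and the property
  is pulled back along \<open>fst\<close>.\<close>

lemma AE_pair_fst:
  assumes "prob_space M2" "AE x in M1. P x"
  shows "AE z in M1 \<Otimes>\<^sub>M M2. P (fst z)"
proof -
  have "AE x in distr (M1 \<Otimes>\<^sub>M M2) M1 fst. P x"
    using assms(2) by (simp only: prob_space.distr_pair_fst[OF assms(1)])
  then show ?thesis
    by (rule AE_distrD[rotated]) simp
qed

text \<open>\<open>bernoulli_pmf\<close> clips its parameter to the unit interval. In this form the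
  probabilities are visibly measurable in the parameter.\<close>

lemma pmf_bernoulli_clipped:
  "pmf (bernoulli_pmf p) b = (if b then min 1 (max 0 p) else 1 - min 1 (max 0 p))"
  by (simp add: bernoulli_pmf.rep_eq)

lemma borel_measurable_edge_weight [measurable]:
  "(\<lambda>s. edge_weight c \<Delta> N s b) \<in> borel_measurable borel"
  unfolding edge_weight_def by measurable

lemma borel_measurable_edge_prob [measurable]:
  "(\<lambda>s. edge_prob c \<Delta> N s) \<in> borel_measurable borel"
  unfolding edge_prob_def by measurable

text \<open>An almost sure equality alone does not evaluate an integral: it is 0 for a non-measurable
  integrand. The index set of \<^const>\<open>point_data\<close> depends on the configuration, so measurability is
  shown separately on each of the countably many events fixing the numbers of points.\<close>
lemma borel_measurable_point_average:
  fixes M :: "'m measure" and L1 L2 :: "'m \<Rightarrow> nat \<Rightarrow> config"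
    and h :: "(nat \<Rightarrow> real) \<Rightarrow> (nat \<Rightarrow> real) \<Rightarrow> real"
  assumes n1 [measurable]: "\<And>i. i \<in> {1..N} \<Longrightarrow> (\<lambda>\<omega>. fst (L1 \<omega> i)) \<in> M \<rightarrow>\<^sub>M count_space UNIV"
    and n2 [measurable]: "\<And>i. i \<in> {1..N} \<Longrightarrow> (\<lambda>\<omega>. fst (L2 \<omega> i)) \<in> M \<rightarrow>\<^sub>M count_space UNIV"
    and z1 [measurable]: "\<And>i k. i \<in> {1..N} \<Longrightarrow> (\<lambda>\<omega>. snd (L1 \<omega> i) k) \<in> borel_measurable M"
    and z2 [measurable]: "\<And>i k. i \<in> {1..N} \<Longrightarrow> (\<lambda>\<omega>. snd (L2 \<omega> i) k) \<in> borel_measurable M"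
    and P: "finite (set_pmf P)"
  shows "(\<lambda>\<omega>. measure_pmf.expectation
      (pair_pmf (point_data c \<Delta> N X (L1 \<omega>)) (point_data c \<Delta> N Y (L2 \<omega>))) (\<lambda>(G1, G2).
        ln (measure_pmf.expectation P (\<lambda>(x, y).
          exp (h x y + (point_hamiltonian c \<Delta> N (L1 \<omega>) G1 x + point_hamiltonian c \<Delta> N (L2 \<omega>) G2 y))))))
    \<in> borel_measurable M"
proof -
  \<comment> \<open>\<open>J\<close>, \<open>Q\<close>, \<open>H\<close> and \<open>F\<close> are
    the index set, the observation law, the Hamiltonian and the average with the numbers of points
    frozen at \<open>m\<close>.\<close>
  define J where "J = (\<lambda>m. SIGMA i:{1..N}. {..<m i :: nat})"
  define Q where "Q = (\<lambda>m (L :: nat \<Rightarrow> config) X. Pi_pmf (J m) False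
    (\<lambda>(i, k). bernoulli_pmf (edge_prob c \<Delta> N (X i * snd (L i) k))))"
  define H where "H = (\<lambda>m (L :: nat \<Rightarrow> config) G x.
    \<Sum>i=1..N. \<Sum>k<m i. ln (edge_weight c \<Delta> N (x i * snd (L i) k) (G (i, k))))"
  define F where "F = (\<lambda>(m1, m2) \<omega>. measure_pmf.expectation
      (pair_pmf (Q m1 (L1 \<omega>) X) (Q m2 (L2 \<omega>) Y)) (\<lambda>(G1, G2).
        ln (measure_pmf.expectation P (\<lambda>(x, y). exp (h x y + (H m1 (L1 \<omega>) G1 x + H m2 (L2 \<omega>) G2 y))))))"
  \<comment> \<open>Restriction to \<open>{1..N}\<close> leaves only countably many possible
    values.\<close>
  define count where "count = (\<lambda>\<omega>. (restrict (\<lambda>i. fst (L1 \<omega> i)) {1..N}, restrict (\<lambda>i. fst (L2 \<omega> i)) {1..N}))"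
  define I where "I = PiE {1..N} (\<lambda>_. UNIV :: nat set)"
  have "(\<lambda>\<omega>. F (count \<omega>) \<omega>) \<in> borel_measurable M"
  proof (rule measurable_compose_countable'[where I="I \<times> I"])
    show "countable (I \<times> I)"
      unfolding I_def by (intro countable_SIGMA countable_PiE) auto
    show "count \<in> M \<rightarrow>\<^sub>M count_space (I \<times> I)"
    proof (subst measurable_count_space_eq_countable, rule \<open>countable (I \<times> I)\<close>, intro conjI ballI)
      show "count \<in> space M \<rightarrow> I \<times> I"
        by (auto simp: count_def I_def)
      fix m assume "m \<in> I \<times> I"
      then have "count -` {m} \<inter> space M = {\<omega> \<in> space M.
        (\<forall>i\<in>{1..N}. fst (L1 \<omega> i) = fst m i) \<and> (\<forall>i\<in>{1..N}. fst (L2 \<omega> i) = snd m i)}"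
        by (cases m) (auto simp: count_def I_def fun_eq_iff PiE_def extensional_def)
      also have "\<dots> \<in> sets M"
        by measurable
      finally show "count -` {m} \<inter> space M \<in> sets M" .
    qed
    fix m assume "m \<in> I \<times> I"
    obtain m1 m2 where m: "m = (m1, m2)" by (cases m)
    have finJ: "finite (J m)" for m
      by (simp add: J_def)
    \<comment> \<open>A finite set containing the support for all positions of the points, so that
      the expectation becomes a finite sum over a fixed index set.\<close>
    define D where "D = (\<lambda>m. PiE_dflt (J m) False (\<lambda>_. UNIV :: bool set))"
    have finD: "finite (D m)" for m
      unfolding D_def using finJ by (intro finite_PiE_dflt) auto
    have Q: "set_pmf (Q m L X) \<subseteq> D m" for m L X
      unfolding Q_def D_def using set_Pi_pmf_subset'[OF finJ[of m]] by (fastforce simp: PiE_dflt_def)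
    have pmfQ: "pmf (Q m L X) G = (\<Prod>(i, k)\<in>J m. pmf (bernoulli_pmf (edge_prob c \<Delta> N (X i * snd (L i) k))) (G (i, k)))"
      if "G \<in> D m" for m L X G
      unfolding Q_def using that by (subst pmf_Pi'[OF finJ]) (auto simp: D_def PiE_dflt_def split_beta)
    have "F m \<omega> = (\<Sum>(G1, G2)\<in>D m1 \<times> D m2.
        ((\<Prod>(i, k)\<in>J m1. pmf (bernoulli_pmf (edge_prob c \<Delta> N (X i * snd (L1 \<omega> i) k))) (G1 (i, k))) *
         (\<Prod>(i, k)\<in>J m2. pmf (bernoulli_pmf (edge_prob c \<Delta> N (Y i * snd (L2 \<omega> i) k))) (G2 (i, k)))) *
        ln (\<Sum>z\<in>set_pmf P. pmf P z *
          exp (h (fst z) (snd z) + (H m1 (L1 \<omega>) G1 (fst z) + H m2 (L2 \<omega>) G2 (snd z)))))" (is "_ = ?sum \<omega>") for \<omega>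
    proof -
      have "F m \<omega> = (\<Sum>z\<in>D m1 \<times> D m2. pmf (pair_pmf (Q m1 (L1 \<omega>) X) (Q m2 (L2 \<omega>) Y)) z *\<^sub>R
        (case z of (G1, G2) \<Rightarrow>
        ln (measure_pmf.expectation P (\<lambda>(x, y). exp (h x y + (H m1 (L1 \<omega>) G1 x + H m2 (L2 \<omega>) G2 y))))))"
        unfolding F_def m prod.case using Q finD by (intro integral_measure_pmf) auto
      also have "\<dots> = ?sum \<omega>"
        by (intro sum.cong refl) (auto simp: pmf_pair pmfQ integral_measure_pmf[OF P] case_prod_unfold)
      finally show ?thesis .
    qed
    moreover have "(\<lambda>\<omega>. \<Sum>(G1, G2)\<in>D m1 \<times> D m2.
        ((\<Prod>(i, k)\<in>J m1. pmf (bernoulli_pmf (edge_prob c \<Delta> N (X i * snd (L1 \<omega> i) k))) (G1 (i, k))) *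
         (\<Prod>(i, k)\<in>J m2. pmf (bernoulli_pmf (edge_prob c \<Delta> N (Y i * snd (L2 \<omega> i) k))) (G2 (i, k)))) *
        ln (\<Sum>z\<in>set_pmf P. pmf P z *
          exp (h (fst z) (snd z) + (H m1 (L1 \<omega>) G1 (fst z) + H m2 (L2 \<omega>) G2 (snd z)))))
      \<in> borel_measurable M"
    proof -
      have [measurable]: "(\<lambda>\<omega>. pmf (bernoulli_pmf (edge_prob c \<Delta> N (X i * snd (L1 \<omega> i) k))) b) \<in> borel_measurable M"
        "(\<lambda>\<omega>. pmf (bernoulli_pmf (edge_prob c \<Delta> N (Y i * snd (L2 \<omega> i) k))) b) \<in> borel_measurable M"
        if "i \<in> {1..N}" for i k b
        unfolding pmf_bernoulli_clipped using z1[OF that] z2[OF that] by (cases b; simp; measurable)+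
      have [measurable]: "(\<lambda>\<omega>. H m1 (L1 \<omega>) G x) \<in> borel_measurable M"
        "(\<lambda>\<omega>. H m2 (L2 \<omega>) G x) \<in> borel_measurable M" for G x
        unfolding H_def by measurable
      show ?thesis
        unfolding split_beta
        by (intro borel_measurable_sum borel_measurable_times borel_measurable_prod borel_measurable_ln
            borel_measurable_exp borel_measurable_add borel_measurable_const)
          (auto simp: J_def)
    qed
    ultimately show "F m \<in> borel_measurable M"
      by (simp add: fun_eq_iff cong: measurable_cong)
  qed
  moreover have "F (count \<omega>) \<omega> = measure_pmf.expectation
      (pair_pmf (point_data c \<Delta> N X (L1 \<omega>)) (point_data c \<Delta> N Y (L2 \<omega>))) (\<lambda>(G1, G2).
        ln (measure_pmf.expectation P (\<lambda>(x, y).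
          exp (h x y + (point_hamiltonian c \<Delta> N (L1 \<omega>) G1 x + point_hamiltonian c \<Delta> N (L2 \<omega>) G2 y)))))" for \<omega>
  proof -
    have J: "J (restrict m {1..N}) = (SIGMA i:{1..N}. {..<m i})" for m
      by (auto simp: J_def)
    have H: "H (restrict (\<lambda>i. fst (L i)) {1..N}) L = point_hamiltonian c \<Delta> N L" for L
      by (auto simp: fun_eq_iff H_def point_hamiltonian_def)
    have Q: "Q (restrict (\<lambda>i. fst (L i)) {1..N}) L Z = point_data c \<Delta> N Z L" for L Z
      unfolding Q_def point_data_def J ..
    show ?thesis
      by (simp only: F_def count_def prod.case H Q)
  qed
  ultimately show ?thesis
    by simp
qed

lemma sets_normalised [simp]: "sets (normalised \<mu>) = sets \<mu>"
  by (simp add: normalised_def)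

lemma sets_poisson_process [measurable_cong]:
  "sets (poisson_process \<mu>) = sets (count_space UNIV \<Otimes>\<^sub>M (\<Pi>\<^sub>M k\<in>UNIV. \<mu>))"
  unfolding poisson_process_def by (intro sets_pair_measure_cong sets_PiM_cong) auto

lemma scale_null_measure [simp]: "scale_measure r (null_measure M) = null_measure M"
  by (rule measure_eqI) auto

text \<open>A Poisson law of rate 0 is concentrated at 0, so almost surely there are no points. The
  irrelevant positions are all sampled at 0, which keeps the law a probability measure.\<close>

lemma poisson_family_null_components:
  fixes N :: nat
  defines "\<Phi> \<equiv> poisson_family N (null_measure unit_borel)"
  shows "prob_space \<Phi>" "AE \<Lambda> in \<Phi>. \<forall>i\<in>{1..N}. fst (\<Lambda> i) = 0"
    and "\<And>i. i \<in> {1..N} \<Longrightarrow> (\<lambda>\<Lambda>. fst (\<Lambda> i)) \<in> \<Phi> \<rightarrow>\<^sub>M count_space UNIV"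
    and "\<And>i k. i \<in> {1..N} \<Longrightarrow> (\<lambda>\<Lambda>. snd (\<Lambda> i) k) \<in> borel_measurable \<Phi>"
proof -
  let ?\<mu> = "null_measure unit_borel"
  have \<Phi>: "\<Phi> = (\<Pi>\<^sub>M i\<in>{1..N}. poisson_process ?\<mu>)"
    by (simp add: \<Phi>_def poisson_family_def)
  have pp: "poisson_process ?\<mu> = measure_pmf (return_pmf 0) \<Otimes>\<^sub>M (\<Pi>\<^sub>M k\<in>UNIV. return ?\<mu> 0)"
    by (simp add: poisson_process_def poisson_law_def normalised_def measure_def)
  have prob: "prob_space (\<Pi>\<^sub>M k\<in>(UNIV::nat set). return ?\<mu> 0)"
    by (intro prob_space_PiM prob_space_return) simp
  have prob_pp: "prob_space (poisson_process ?\<mu>)"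
    unfolding pp by (intro prob_space_pair prob measure_pmf.prob_space_axioms)
  show "prob_space \<Phi>"
    unfolding \<Phi> by (intro prob_space_PiM prob_pp)
  have "AE n in measure_pmf (return_pmf (0::nat)). n = 0"
    by (simp add: AE_measure_pmf_iff)
  then have "AE \<omega> in poisson_process ?\<mu>. fst \<omega> = 0"
    unfolding pp by (rule AE_pair_fst[OF prob])
  then show "AE \<Lambda> in \<Phi>. \<forall>i\<in>{1..N}. fst (\<Lambda> i) = 0"
    unfolding \<Phi> by (intro eventually_ball_finite ballI AE_PiM_component prob_pp) auto
  show "(\<lambda>\<Lambda>. fst (\<Lambda> i)) \<in> \<Phi> \<rightarrow>\<^sub>M count_space UNIV" if "i \<in> {1..N}" for i
    unfolding \<Phi> using that by measurable
  have "(\<lambda>x. x) \<in> borel_measurable ?\<mu>"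
    by (subst measurable_cong_sets[of _ unit_borel _ borel]) (auto intro: measurable_restrict_space1)
  then show "(\<lambda>\<Lambda>. snd (\<Lambda> i) k) \<in> borel_measurable \<Phi>" if "i \<in> {1..N}" for i k
    unfolding \<Phi> using that by measurable
qed

text \<open>Almost surely there are no points; the index sets of the observations are then empty and
  both point Hamiltonians are 0.\<close>

lemma free_energy_null:
  "free_energy c \<Delta> p N t (null_measure unit_borel) (null_measure unit_borel) =
    1 / real N * measure_pmf.expectation (pair_pmf (spins_pmf (1/2) N) (spins_pmf p N)) (\<lambda>(X, Y).
      measure_pmf.expectation (graph_data c \<Delta> N t X Y) (\<lambda>D. ln (graph_partition c \<Delta> p N D)))"
proof -
  let ?P = "pair_pmf (spins_pmf (1/2) N) (spins_pmf p N)"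
  let ?\<Phi> = "poisson_family N (null_measure unit_borel)"
  interpret \<Phi>: prob_space ?\<Phi>
    by (rule poisson_family_null_components)
  interpret \<Phi>2: pair_prob_space ?\<Phi> ?\<Phi> ..
  note comp [measurable] = poisson_family_null_components(3,4)[of _ N]
  have AE1: "AE \<omega> in ?\<Phi> \<Otimes>\<^sub>M ?\<Phi>. \<forall>i\<in>{1..N}. fst (fst \<omega> i) = 0"
    by (rule AE_pair_fst[OF \<Phi>.prob_space_axioms poisson_family_null_components(2)])
  have AE2: "AE \<omega> in ?\<Phi> \<Otimes>\<^sub>M ?\<Phi>. \<forall>i\<in>{1..N}. fst (snd \<omega> i) = 0"
    by (rule \<Phi>2.AE_pair_measure) (use poisson_family_null_components(2)[of N] in \<open>auto, measurable\<close>)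
  have "(\<integral>(\<Lambda>1, \<Lambda>2). measure_pmf.expectation
      (pair_pmf (point_data c \<Delta> N X \<Lambda>1) (point_data c \<Delta> N Y \<Lambda>2)) (\<lambda>(G1, G2).
        ln (measure_pmf.expectation ?P (\<lambda>(x, y).
          exp (graph_hamiltonian c \<Delta> N D x y +
            (point_hamiltonian c \<Delta> N \<Lambda>1 G1 x + point_hamiltonian c \<Delta> N \<Lambda>2 G2 y)))))
      \<partial>(?\<Phi> \<Otimes>\<^sub>M ?\<Phi>)) = ln (graph_partition c \<Delta> p N D)" (is "?int = _") for X Y D
  proof -
    have "?int = (\<integral>\<omega>. ln (graph_partition c \<Delta> p N D) \<partial>(?\<Phi> \<Otimes>\<^sub>M ?\<Phi>))"
    proof (rule integral_cong_AE)
      show "(\<lambda>(\<Lambda>1, \<Lambda>2). measure_pmf.expectation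
        (pair_pmf (point_data c \<Delta> N X \<Lambda>1) (point_data c \<Delta> N Y \<Lambda>2)) (\<lambda>(G1, G2).
          ln (measure_pmf.expectation ?P (\<lambda>(x, y).
            exp (graph_hamiltonian c \<Delta> N D x y +
              (point_hamiltonian c \<Delta> N \<Lambda>1 G1 x + point_hamiltonian c \<Delta> N \<Lambda>2 G2 y))))))
        \<in> borel_measurable (?\<Phi> \<Otimes>\<^sub>M ?\<Phi>)"
        using borel_measurable_point_average[where M="?\<Phi> \<Otimes>\<^sub>M ?\<Phi>" and N=N and ?L1.0=fst and ?L2.0=snd
            and P="?P" and h="graph_hamiltonian c \<Delta> N D" and c=c and \<Delta>=\<Delta> and X=X and Y=Y]
        by (simp add: case_prod_unfold)
      show "AE \<omega> in ?\<Phi> \<Otimes>\<^sub>M ?\<Phi>. (case \<omega> of (\<Lambda>1, \<Lambda>2) \<Rightarrow> measure_pmf.expectation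
        (pair_pmf (point_data c \<Delta> N X \<Lambda>1) (point_data c \<Delta> N Y \<Lambda>2)) (\<lambda>(G1, G2).
          ln (measure_pmf.expectation ?P (\<lambda>(x, y).
            exp (graph_hamiltonian c \<Delta> N D x y +
              (point_hamiltonian c \<Delta> N \<Lambda>1 G1 x + point_hamiltonian c \<Delta> N \<Lambda>2 G2 y)))))) =
        ln (graph_partition c \<Delta> p N D)"
        using AE1 AE2
      proof eventually_elim
        case (elim \<omega>)
        have H: "point_hamiltonian c \<Delta> N \<Lambda> G x = 0" and d: "point_data c \<Delta> N x \<Lambda> = return_pmf (\<lambda>_. False)"
          if "\<forall>i\<in>{1..N}. fst (\<Lambda> i) = 0" for \<Lambda> G x
        proof -
          have "(SIGMA i:{1..N}. {..<fst (\<Lambda> i)}) = {}" using that by auto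
          then show "point_data c \<Delta> N x \<Lambda> = return_pmf (\<lambda>_. False)"
            by (simp only: point_data_def pmf_Pi_empty)
          show "point_hamiltonian c \<Delta> N \<Lambda> G x = 0"
            using that by (simp add: point_hamiltonian_def)
        qed
        show ?case
          using H[OF elim(1)] H[OF elim(2)] d[OF elim(1)] d[OF elim(2)]
          by (simp add: case_prod_unfold graph_partition_def)
      qed
    qed simp
    also have "\<dots> = ln (graph_partition c \<Delta> p N D)"
      using \<Phi>2.prob_space by simp
    finally show ?thesis .
  qed
  then show ?thesis
    by (simp only: free_energy_def)
qed

section \<open>Lower bound for the functional at point masses\<close>

lemma sums_expectation_pmf_nat:
  fixes p :: "nat pmf" and f :: "nat \<Rightarrow> real"
  assumes "integrable (measure_pmf p) f"
  shows "(\<lambda>n. pmf p n * f n) sums measure_pmf.expectation p f"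
proof -
  have "integrable (count_space UNIV) (\<lambda>n. pmf p n *\<^sub>R f n)"
    using assms unfolding measure_pmf_eq_density by (subst (asm) integrable_density) auto
  then show ?thesis
    using sums_integral_count_space_nat unfolding measure_pmf_eq_density
    by (subst integral_density) auto
qed

text \<open>Averaged over the spin, the number \<open>n\<close> has a mixed Poisson law with weights
  \<open>exp (- c * t) * t ^ n / fact n * Z n\<close>. Its relative entropy with respect to the
  Poisson law of the same mean is nonnegative, which bounds the mean of \<open>ln (Z n)\<close> from
  below.\<close>

lemma poisson_mixture_entropy_ge:
  assumes c: "0 < \<Delta>" "\<Delta> < c" and t: "0 < t" and q: "0 < q" "q < 1"
  defines "m \<equiv> 2 * q - 1"
  defines "Z \<equiv> \<lambda>n::nat. measure_pmf.expectation (spin_pmf q) (\<lambda>\<sigma>.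
    exp (- \<Delta> * \<sigma> * (t * m)) * (c + \<Delta> * \<sigma> * m) ^ n)"
  shows "t * g_fun c \<Delta> (m * m) \<le> - c * t + measure_pmf.expectation (spin_pmf q) (\<lambda>\<epsilon>.
      measure_pmf.expectation (poisson_pmf (t * (c + \<Delta> * \<epsilon> * m))) (\<lambda>n. ln (Z n)))"
proof -
  \<comment> \<open>\<open>t * \<rho>\<close> is the mean of the mixed law and
    \<open>s = t * \<rho> - c * t\<close>, so \<open>exp (- s) * \<rho> ^ n / Z n\<close> is the
    likelihood ratio of the comparison law to the mixture.\<close>
  define \<rho> where "\<rho> = c + \<Delta> * (m * m)"
  define s where "s = t * \<Delta> * (m * m)"
  define a where "a = c + \<Delta> * m"
  define b where "b = c - \<Delta> * m"
  have m: "\<bar>m\<bar> < 1" using q by (auto simp: m_def)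
  have "- \<Delta> \<le> \<Delta> * m" "\<Delta> * m \<le> \<Delta>"
    using m c mult_left_mono[of "- 1" m \<Delta>] mult_left_mono[of m 1 \<Delta>] by auto
  then have ab: "0 < a" "0 < b" using c unfolding a_def b_def by linarith+
  have \<rho>: "0 < \<rho>" using c by (auto simp: \<rho>_def intro!: add_pos_nonneg)
  have Z: "Z n = q * (exp (- (t * \<Delta> * m)) * a ^ n) + (1 - q) * (exp (t * \<Delta> * m) * b ^ n)" for n
    using q by (simp add: Z_def expectation_spin_pmf a_def b_def mult_ac)
  \<comment> \<open>\<open>k * a ^ n\<close> is the share of the spin 1 in \<open>Z n\<close>. This
    lower bound dominates the quotients \<open>w ^ n / Z n\<close> by a geometric sequence, which
    every Poisson law integrates.\<close>
  define k where "k = q * exp (- (t * \<Delta> * m))"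
  have k: "0 < k" using q by (simp add: k_def)
  have Zge: "k * a ^ n \<le> Z n" for n
    using q ab by (simp add: Z k_def)
  have Zpos: "0 < Z n" for n
    using Zge[of n] k ab by (meson less_le_trans mult_pos_pos zero_less_power)
  have quot: "w ^ n / Z n \<le> 1 / k * (w / a) ^ n" if "0 < w" for w n
  proof -
    have "w ^ n / Z n \<le> w ^ n / (k * a ^ n)"
      using Zge[of n] Zpos[of n] k ab that by (intro divide_left_mono) auto
    then show ?thesis by (simp add: power_divide)
  qed
  have intquot: "integrable (measure_pmf (poisson_pmf r)) (\<lambda>n. w ^ n / Z n)" if "0 < r" "0 < w" for r w
  proof (rule Bochner_Integration.integrable_bound)
    show "integrable (measure_pmf (poisson_pmf r)) (\<lambda>n. 1 / k * (w / a) ^ n)"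
      using poisson_pmf_power(1)[OF that(1), of "w / a"] by (intro integrable_mult_right) auto
    show "AE n in poisson_pmf r. norm (w ^ n / Z n) \<le> norm (1 / k * (w / a) ^ n)"
      using quot[OF that(2)] Zpos k ab that by (intro AE_pmfI) (simp add: abs_mult less_imp_le)
  qed auto
  have intZ: "integrable (measure_pmf (poisson_pmf r)) Z" if "0 < r" for r
  proof -
    have "integrable (measure_pmf (poisson_pmf r))
        (\<lambda>n. q * (exp (- (t * \<Delta> * m)) * a ^ n) + (1 - q) * (exp (t * \<Delta> * m) * b ^ n))"
      by (intro Bochner_Integration.integrable_add integrable_mult_right poisson_pmf_power(1) that)
    then show ?thesis by (simp add: Z[abs_def])
  qed
  have intln: "integrable (measure_pmf (poisson_pmf r)) (\<lambda>n. ln (Z n))" if "0 < r" for r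
  proof (rule Bochner_Integration.integrable_bound)
    show "integrable (measure_pmf (poisson_pmf r)) (\<lambda>n. Z n + 1 ^ n / Z n)"
      \<comment> \<open>The second summand is the case \<open>w = 1\<close> of
        \<open>intquot\<close>.\<close>
      by (intro Bochner_Integration.integrable_add intZ intquot that) simp
    have "ln (Z n) \<le> Z n - 1" "- ln (Z n) \<le> 1 / Z n - 1" for n
      using ln_le_minus_one[OF Zpos[of n]] ln_le_minus_one[of "1 / Z n"] Zpos[of n] by (auto simp: ln_div)
    then have "\<bar>ln (Z n)\<bar> \<le> Z n + 1 / Z n" for n
      using Zpos[of n] by (simp add: abs_le_iff) (smt (verit) divide_pos_pos)
    moreover have "\<bar>Z n + 1 / Z n\<bar> = Z n + 1 / Z n" for n
      using Zpos[of n] by simp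
    ultimately show "AE n in poisson_pmf r. norm (ln (Z n)) \<le> norm (Z n + 1 ^ n / Z n)"
      by (intro AE_pmfI) simp
  qed auto
  define K where "K = (\<lambda>r. measure_pmf.expectation (poisson_pmf r) (\<lambda>n. \<rho> ^ n / Z n))"
  \<comment> \<open>\<open>ln u \<le> u - 1\<close> at the likelihood ratio, integrated for a single
    spin value. The term with \<open>K r\<close> becomes a total mass only after averaging over the
    spin.\<close>
  have gibbs: "- s + r * ln \<rho> + 1 - exp (- s) * K r \<le> measure_pmf.expectation (poisson_pmf r) (\<lambda>n. ln (Z n))"
    if r: "0 < r" for r
  proof -
    have "- s + r * ln \<rho> + 1 - exp (- s) * K r =
      measure_pmf.expectation (poisson_pmf r) (\<lambda>n. (- s + 1) + real n * ln \<rho> - exp (- s) * (\<rho> ^ n / Z n))"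
      unfolding K_def using poisson_pmf_mean[OF r] intquot[OF r \<rho>]
      by (simp del: times_divide_eq_right)
    also have "\<dots> \<le> measure_pmf.expectation (poisson_pmf r) (\<lambda>n. ln (Z n))"
    proof (rule integral_mono)
      show "integrable (measure_pmf (poisson_pmf r)) (\<lambda>n. (- s + 1) + real n * ln \<rho> - exp (- s) * (\<rho> ^ n / Z n))"
        using poisson_pmf_mean[OF r] intquot[OF r \<rho>] by (simp del: times_divide_eq_right)
      fix n
      have "ln (exp (- s) * \<rho> ^ n / Z n) \<le> exp (- s) * \<rho> ^ n / Z n - 1"
        using Zpos[of n] \<rho> by (intro ln_le_minus_one) auto
      moreover have "ln (exp (- s) * \<rho> ^ n / Z n) = - s + real n * ln \<rho> - ln (Z n)"
        using Zpos[of n] \<rho> by (simp add: ln_div ln_mult ln_realpow)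
      ultimately show "(- s + 1) + real n * ln \<rho> - exp (- s) * (\<rho> ^ n / Z n) \<le> ln (Z n)"
        by simp
    qed (rule intln[OF r])
    finally show ?thesis .
  qed
  \<comment> \<open>Averaged over the spin, the Poisson weight of \<open>n\<close> is proportional to \<open>t ^ n / fact n * Z n\<close>.\<close>
  have mixture: "q * K (t * a) + (1 - q) * K (t * b) = exp s"
  proof (rule sums_unique2)
    show "(\<lambda>n. q * (pmf (poisson_pmf (t * a)) n * (\<rho> ^ n / Z n)) + (1 - q) * (pmf (poisson_pmf (t * b)) n * (\<rho> ^ n / Z n)))
        sums (q * K (t * a) + (1 - q) * K (t * b))"
      unfolding K_def using t ab \<rho> by (intro sums_add sums_mult sums_expectation_pmf_nat intquot) auto
    have "(\<lambda>n. exp (- (c * t)) * ((t * \<rho>) ^ n /\<^sub>R fact n)) sums (exp (- (c * t)) * exp (t * \<rho>))"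
      by (intro sums_mult exp_converges)
    moreover have "exp (- (c * t)) * exp (t * \<rho>) = exp s"
      by (simp add: s_def \<rho>_def algebra_simps flip: exp_add)
    moreover have "q * (pmf (poisson_pmf (t * a)) n * (\<rho> ^ n / Z n)) + (1 - q) * (pmf (poisson_pmf (t * b)) n * (\<rho> ^ n / Z n))
        = exp (- (c * t)) * ((t * \<rho>) ^ n /\<^sub>R fact n)" for n
    proof -
      have ea: "exp (- (t * a)) = exp (- (c * t)) * exp (- (t * \<Delta> * m))"
        and eb: "exp (- (t * b)) = exp (- (c * t)) * exp (t * \<Delta> * m)"
        by (simp_all add: a_def b_def algebra_simps flip: exp_add)
      have "q * (pmf (poisson_pmf (t * a)) n * (\<rho> ^ n / Z n)) + (1 - q) * (pmf (poisson_pmf (t * b)) n * (\<rho> ^ n / Z n))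
        = exp (- (c * t)) * (t ^ n / fact n) * (\<rho> ^ n / Z n) *
          (q * (exp (- (t * \<Delta> * m)) * a ^ n) + (1 - q) * (exp (t * \<Delta> * m) * b ^ n))"
        using t ab by (simp add: ea eb power_mult_distrib divide_inverse) (simp add: algebra_simps)
      also have "\<dots> = exp (- (c * t)) * (t ^ n / fact n) * (\<rho> ^ n / Z n) * Z n"
        by (simp only: Z)
      also have "\<dots> = exp (- (c * t)) * ((t * \<rho>) ^ n /\<^sub>R fact n)"
        using Zpos[of n] by (simp add: power_mult_distrib divide_inverse)
      finally show ?thesis .
    qed
    ultimately show "(\<lambda>n. q * (pmf (poisson_pmf (t * a)) n * (\<rho> ^ n / Z n)) + (1 - q) * (pmf (poisson_pmf (t * b)) n * (\<rho> ^ n / Z n)))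
        sums exp s"
      by simp
  qed
  have mean: "q * a + (1 - q) * b = \<rho>"
    by (simp add: a_def b_def \<rho>_def m_def algebra_simps)
  \<comment> \<open>By \<open>mixture\<close> the terms with \<open>K\<close> average to
    \<open>exp (- s) * exp s = 1\<close>, which cancels the \<open>+ 1\<close>.\<close>
  have "t * g_fun c \<Delta> (m * m) = - c * t + (- s + t * (q * a + (1 - q) * b) * ln \<rho> + 1 - exp (- s) * exp s)"
    unfolding mean by (simp add: g_fun_def s_def \<rho>_def algebra_simps flip: exp_add)
  also have "\<dots> = - c * t + (q * (- s + t * a * ln \<rho> + 1 - exp (- s) * K (t * a)) +
      (1 - q) * (- s + t * b * ln \<rho> + 1 - exp (- s) * K (t * b)))"
    by (simp add: mixture[symmetric] algebra_simps)
  also have "\<dots> \<le> - c * t + (q * measure_pmf.expectation (poisson_pmf (t * a)) (\<lambda>n. ln (Z n)) +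
      (1 - q) * measure_pmf.expectation (poisson_pmf (t * b)) (\<lambda>n. ln (Z n)))"
    using q t ab by (intro add_left_mono add_mono mult_left_mono gibbs) auto
  also have "\<dots> = - c * t + measure_pmf.expectation (spin_pmf q) (\<lambda>\<epsilon>.
      measure_pmf.expectation (poisson_pmf (t * (c + \<Delta> * \<epsilon> * m))) (\<lambda>n. ln (Z n)))"
    using q by (simp add: expectation_spin_pmf a_def b_def)
  finally show ?thesis .
qed

section \<open>The functional at point masses\<close>

abbreviation point_mass :: "real \<Rightarrow> real measure" where
  "point_mass a \<equiv> return unit_borel a"

lemma prob_space_point_mass: "a \<in> {-1..1} \<Longrightarrow> prob_space (point_mass a)"
  by (intro prob_space_return) (simp add: space_restrict_space)

lemma measurable_id_unit_borel [measurable]: "(\<lambda>x. x) \<in> borel_measurable unit_borel"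
  by (rule measurable_restrict_space1) simp

lemma plus_scaled_null:
  assumes "sets \<nu> = sets unit_borel" "0 \<le> t"
  shows "plus_scaled (null_measure unit_borel) t \<nu> = scale_measure (ennreal t) \<nu>"
  using assms by (intro measure_eqI) (auto simp: emeasure_plus_scaled)

lemma poisson_process_scaled_point_mass:
  assumes a: "a \<in> {-1..1}" and r: "0 < r"
  shows "poisson_process (scale_measure (ennreal r) (point_mass a)) =
    measure_pmf (poisson_pmf r) \<Otimes>\<^sub>M (\<Pi>\<^sub>M k\<in>UNIV. point_mass a)"
proof -
  interpret prob_space "point_mass a" by (rule prob_space_point_mass[OF a])
  have total: "emeasure (point_mass a) {-1..1} = 1"
    using emeasure_space_1 by (simp add: space_restrict_space)
  have "measure (scale_measure (ennreal r) (point_mass a))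
      (space (scale_measure (ennreal r) (point_mass a))) = r"
    using r total by (simp add: measure_def space_scale_measure space_restrict_space)
  moreover have "normalised (scale_measure (ennreal r) (point_mass a)) = point_mass a"
  proof (rule measure_eqI)
    fix A assume "A \<in> sets (normalised (scale_measure (ennreal r) (point_mass a)))"
    have "1 / ennreal r * ennreal r = 1"
      using r by (simp add: ennreal_divide_times)
    then show "emeasure (normalised (scale_measure (ennreal r) (point_mass a))) A = emeasure (point_mass a) A"
      using r total by (simp add: normalised_def space_scale_measure space_restrict_space flip: mult.assoc)
  qed simp
  ultimately show ?thesis
    using r by (simp add: poisson_process_def poisson_law_def)
qed

text \<open>Only the value of the density at the atom counts, so tilting by the spin merely changes
  the weight of the atom.\<close>

lemma density_scaled_point_mass:
  assumes "a \<in> {-1..1}" "0 \<le> t" "0 \<le> c + \<Delta> * \<epsilon> * a"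
  shows "density (scale_measure (ennreal t) (point_mass a)) (\<lambda>x. ennreal (c + \<Delta> * \<epsilon> * x)) =
    scale_measure (ennreal (t * (c + \<Delta> * \<epsilon> * a))) (point_mass a)"
proof (rule measure_eqI)
  fix A assume "A \<in> sets (density (scale_measure (ennreal t) (point_mass a)) (\<lambda>x. ennreal (c + \<Delta> * \<epsilon> * x)))"
  then have A [measurable]: "A \<in> sets unit_borel" by simp
  have [measurable]: "(\<lambda>x. ennreal (c + \<Delta> * \<epsilon> * x)) \<in> borel_measurable (scale_measure (ennreal t) (point_mass a))"
    by (subst measurable_cong_sets[of _ unit_borel _ borel]) auto
  have "emeasure (density (scale_measure (ennreal t) (point_mass a)) (\<lambda>x. ennreal (c + \<Delta> * \<epsilon> * x))) A =
      ennreal t * (ennreal (c + \<Delta> * \<epsilon> * a) * indicator A a)"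
    using assms by (subst emeasure_density)
      (auto simp: nn_integral_scale_measure nn_integral_return space_restrict_space)
  then show "emeasure (density (scale_measure (ennreal t) (point_mass a)) (\<lambda>x. ennreal (c + \<Delta> * \<epsilon> * x))) A =
      emeasure (scale_measure (ennreal (t * (c + \<Delta> * \<epsilon> * a))) (point_mass a)) A"
    using A assms by (simp add: ennreal_mult mult.assoc)
qed simp

lemma integral_scaled_point_mass:
  assumes "a \<in> {-1..1}" "0 \<le> t"
  shows "(\<integral>x. x \<partial>scale_measure (ennreal t) (point_mass a)) = t * a"
proof -
  have "scale_measure (ennreal t) (point_mass a) = density (point_mass a) (\<lambda>_. ennreal t)"
    by (rule measure_eqI) (auto simp: emeasure_density nn_integral_cmult_indicator)
  then show ?thesis
    using assms by (simp add: integral_density integral_return space_restrict_space)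
qed

text \<open>Almost surely all points sit at \<open>a\<close>, so only their Poisson number remains
  random.\<close>

lemma integral_poisson_process_scaled_point_mass:
  fixes f :: "nat \<Rightarrow> (nat \<Rightarrow> real) \<Rightarrow> real"
  assumes a: "a \<in> {-1..1}" and r: "0 < r"
    and f: "\<And>n. f n \<in> borel_measurable (\<Pi>\<^sub>M k\<in>UNIV. unit_borel)"
  shows "(\<integral>(n, z). f n z \<partial>poisson_process (scale_measure (ennreal r) (point_mass a))) =
    measure_pmf.expectation (poisson_pmf r) (\<lambda>n. f n (\<lambda>_. a))"
proof -
  let ?M = "measure_pmf (poisson_pmf r)" and ?Z = "\<Pi>\<^sub>M k\<in>(UNIV::nat set). point_mass a"
  have prob: "prob_space (point_mass a)" by (rule prob_space_point_mass[OF a])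
  interpret Z: prob_space ?Z by (intro prob_space_PiM prob)
  interpret pair_prob_space ?M ?Z ..
  have [measurable]: "f n \<in> borel_measurable ?Z" for n
    using f[of n] by (simp cong: measurable_cong_sets sets_PiM_cong)
  \<comment> \<open>The first component is countably valued, which reduces joint measurability to
    that of each \<open>f n\<close>.\<close>
  have meas1: "(\<lambda>\<omega>. f (fst \<omega>) (snd \<omega>)) \<in> borel_measurable (?M \<Otimes>\<^sub>M ?Z)"
    by (rule measurable_compose_countable[where g=fst]) measurable
  have meas2: "(\<lambda>\<omega>. f (fst \<omega>) (\<lambda>_. a)) \<in> borel_measurable (?M \<Otimes>\<^sub>M ?Z)"
    by (rule measurable_compose[OF measurable_fst]) simp
  have "AE z in ?Z. \<forall>k. z k = a"
  proof (subst AE_all_countable, intro allI AE_PiM_component prob)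
    show "AE x in point_mass a. x = a"
      using a by (subst AE_return) (auto simp: space_restrict_space)
  qed auto
  then have "AE z in ?Z. f n z = f n (\<lambda>_. a)" for n
    by eventually_elim (auto simp: fun_eq_iff[symmetric] intro!: arg_cong[where f="f n"])
  then have "AE \<omega> in ?M \<Otimes>\<^sub>M ?Z. f (fst \<omega>) (snd \<omega>) = f (fst \<omega>) (\<lambda>_. a)"
    by (intro AE_pair_measure borel_measurable_eq meas1 meas2) auto
  then have "(\<integral>\<omega>. f (fst \<omega>) (snd \<omega>) \<partial>(?M \<Otimes>\<^sub>M ?Z)) = (\<integral>\<omega>. f (fst \<omega>) (\<lambda>_. a) \<partial>(?M \<Otimes>\<^sub>M ?Z))"
    by (intro integral_cong_AE meas1 meas2)
  also have "\<dots> = (\<integral>n. f n (\<lambda>_. a) \<partial>distr (?M \<Otimes>\<^sub>M ?Z) ?M fst)"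
    by (subst integral_distr) auto
  also have "\<dots> = (\<integral>n. f n (\<lambda>_. a) \<partial>?M)"
    by (simp only: Z.distr_pair_fst)
  finally show ?thesis
    by (simp add: poisson_process_scaled_point_mass[OF a r] case_prod_unfold)
qed

text \<open>The product over the points becomes a power, and the tilted intensity has total mass
  \<open>t * (c + \<Delta> * \<epsilon> * a)\<close>.\<close>

lemma psi_scaled_point_mass:
  assumes c: "0 < \<Delta>" "\<Delta> < c" and t: "0 < t" and a: "a \<in> {-1..1}"
  shows "psi c \<Delta> (spin_pmf q) (scale_measure (ennreal t) (point_mass a)) =
    - c * t + measure_pmf.expectation (spin_pmf q) (\<lambda>\<epsilon>.
      measure_pmf.expectation (poisson_pmf (t * (c + \<Delta> * \<epsilon> * a))) (\<lambda>n.
        ln (measure_pmf.expectation (spin_pmf q) (\<lambda>\<sigma>.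
          exp (- \<Delta> * \<sigma> * (t * a)) * (c + \<Delta> * \<sigma> * a) ^ n))))"
proof -
  let ?\<mu> = "scale_measure (ennreal t) (point_mass a)"
  interpret prob_space "point_mass a" by (rule prob_space_point_mass[OF a])
  have mass: "measure ?\<mu> (space ?\<mu>) = t"
    using emeasure_space_1 t by (simp add: measure_def space_scale_measure)
  have "(\<integral>(n, z). ln (measure_pmf.expectation (spin_pmf q) (\<lambda>\<sigma>.
          exp (- \<Delta> * \<sigma> * (t * a)) * (\<Prod>k<n. c + \<Delta> * \<sigma> * z k)))
      \<partial>poisson_process (density ?\<mu> (\<lambda>x. ennreal (c + \<Delta> * \<epsilon> * x)))) =
    measure_pmf.expectation (poisson_pmf (t * (c + \<Delta> * \<epsilon> * a))) (\<lambda>n.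
        ln (measure_pmf.expectation (spin_pmf q) (\<lambda>\<sigma>.
          exp (- \<Delta> * \<sigma> * (t * a)) * (c + \<Delta> * \<sigma> * a) ^ n)))"
    if "\<epsilon> \<in> set_pmf (spin_pmf q)" for \<epsilon>
  proof -
    have "\<epsilon> = -1 \<or> \<epsilon> = 1"
      using that set_spin_pmf by blast
    then have "\<Delta> * \<epsilon> * a = \<Delta> * a \<or> \<Delta> * \<epsilon> * a = - (\<Delta> * a)"
      by auto
    moreover have "- \<Delta> \<le> \<Delta> * a" "\<Delta> * a \<le> \<Delta>"
      using a c mult_left_mono[of "- 1" a \<Delta>] mult_left_mono[of a 1 \<Delta>] by auto
    ultimately have pos: "0 < c + \<Delta> * \<epsilon> * a"
      using c by linarith
    show ?thesis
      unfolding density_scaled_point_mass[OF a less_imp_le[OF t] less_imp_le[OF pos]]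
      using t pos
      by (subst integral_poisson_process_scaled_point_mass[OF a])
        (auto simp: integral_measure_pmf[of "set_pmf (spin_pmf q)"])
  qed
  then show ?thesis
    unfolding psi_def mass integral_scaled_point_mass[OF a less_imp_le[OF t]]
    by (intro arg_cong2[where f="(+)"] refl integral_cong_AE AE_pmfI) auto
qed

lemma point_mass_mem_prob_with_mean:
  assumes "2 * q - 1 \<in> {-1..1}"
  shows "point_mass (2 * q - 1) \<in> prob_with_mean q"
  using assms prob_space_point_mass[OF assms]
  by (simp add: prob_with_mean_def integral_return space_restrict_space)

text \<open>With the first measure concentrated at 0, its \<open>psi\<close> term equals
  \<open>t * g_fun c \<Delta> 0\<close>, and so does the subtracted interaction term, as
  \<open>x * y = 0\<close>. They cancel and \<open>psi\<close> at the second point mass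
  remains.\<close>

lemma parisi_functional_point_masses_ge:
  assumes c: "0 < \<Delta>" "\<Delta> < c" and t: "0 < t" and p: "0 < p" "p < 1"
  defines "m \<equiv> 2 * p - 1"
  shows "t * g_fun c \<Delta> (m * m) \<le> parisi_functional c \<Delta> p t
    (null_measure unit_borel) (null_measure unit_borel) (point_mass 0) (point_mass m)"
proof -
  have m: "m \<in> {-1..1}" and z: "0 \<in> {-1..1::real}" using p by (auto simp: m_def)
  have r: "0 < t * c" using c t by simp
  \<comment> \<open>At the point 0 the inner expectation is \<open>c ^ n\<close> for either spin, so
    the value is \<open>- c * t + t * c * ln c\<close>.\<close>
  have "psi c \<Delta> (spin_pmf (1/2)) (scale_measure (ennreal t) (point_mass 0)) = t * g_fun c \<Delta> 0"
    unfolding psi_scaled_point_mass[OF c t z]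
    using poisson_pmf_mean(2)[OF r] c
    by (simp add: expectation_spin_pmf ln_realpow g_fun_def algebra_simps)
  moreover have "t * g_fun c \<Delta> (m * m) \<le> psi c \<Delta> (spin_pmf p) (scale_measure (ennreal t) (point_mass m))"
    unfolding psi_scaled_point_mass[OF c t m] unfolding m_def by (rule poisson_mixture_entropy_ge[OF c t p])
  moreover have "(\<integral>x. (\<integral>y. g_fun c \<Delta> (x * y) \<partial>point_mass m) \<partial>point_mass 0) = g_fun c \<Delta> 0"
  proof -
    have meas: "(\<lambda>y. g_fun c \<Delta> (x * y)) \<in> borel_measurable unit_borel" for x
      unfolding g_fun_def by measurable
    have "(\<integral>y. g_fun c \<Delta> (x * y) \<partial>point_mass m) = g_fun c \<Delta> (m * x)" for x
      using meas[of x] m by (subst integral_return) (auto simp: space_restrict_space mult.commute)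
    then show ?thesis
      using meas[of m] by (simp add: integral_return space_restrict_space)
  qed
  ultimately show ?thesis
    using t by (simp add: parisi_functional_def plus_scaled_null)
qed

text \<open>The function \<open>u * (ln u - 1)\<close> has derivative \<open>ln u\<close>, which is
  positive for \<open>u > 1\<close>.\<close>

lemma g_fun_strict_mono:
  assumes "0 < \<Delta>" "1 \<le> c" "0 \<le> x" "x < y"
  shows "g_fun c \<Delta> x < g_fun c \<Delta> y"
proof -
  have "a * (ln a - 1) < b * (ln b - 1)" if "1 \<le> a" "a < b" for a b :: real
  \<comment> \<open>The derivative vanishes at the possible endpoint \<open>a = 1\<close>, so
    positivity is asked on the open interval.\<close>
  proof (rule DERIV_pos_imp_increasing_open[OF that(2)])
    show "\<exists>l. ((\<lambda>u. u * (ln u - 1)) has_real_derivative l) (at u) \<and> 0 < l" if "a < u" "u < b" for u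
      using that \<open>1 \<le> a\<close> by (intro exI[of _ "ln u"]) (auto intro!: derivative_eq_intros)
    show "continuous_on {a..b} (\<lambda>u. u * (ln u - 1))"
      using \<open>1 \<le> a\<close> by (intro continuous_intros) auto
  qed
  moreover have "1 \<le> c + \<Delta> * x" "c + \<Delta> * x < c + \<Delta> * y"
    using assms by (auto intro: add_increasing2)
  ultimately show ?thesis
    unfolding g_fun_def by blast
qed

section \<open>Comparison of both sides at a small positive time\<close>

theorem proposition7p1:
  fixes c \<Delta> :: real
  assumes "0 < \<Delta>" and "\<Delta> < c" and "exp 1 < c"
  shows "\<exists>\<eta>>0. \<forall>p. 0 < p \<and> p < 1 \<and> 2 * p - 1 \<noteq> 0 \<and> \<bar>2 * p - 1\<bar> < \<eta> \<longrightarrow>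
    \<not> (\<exists>\<delta>>0. \<forall>t\<in>{0..<\<delta>}.
        variational_formula c \<Delta> p t (null_measure unit_borel) (null_measure unit_borel))"
\<comment> \<open>\<open>\<eta> = 1\<close> works: the gap found below is positive for each nonzero
  \<open>m\<close>.\<close>
proof (rule exI[of _ 1], intro conjI allI impI notI)
  fix p :: real
  assume "0 < p \<and> p < 1 \<and> 2 * p - 1 \<noteq> 0 \<and> \<bar>2 * p - 1\<bar> < 1"
  then have p: "0 < p" "p < 1" and m0: "2 * p - 1 \<noteq> 0" by auto
  define m where "m = 2 * p - 1"
  let ?\<mu> = "null_measure unit_borel"
  assume "\<exists>\<delta>>0. \<forall>t\<in>{0..<\<delta>}. variational_formula c \<Delta> p t ?\<mu> ?\<mu>"
  then obtain \<delta> where \<delta>: "0 < \<delta>" "\<And>t. 0 \<le> t \<Longrightarrow> t < \<delta> \<Longrightarrow> variational_formula c \<Delta> p t ?\<mu> ?\<mu>"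
    by auto
  \<comment> \<open>\<open>exp 1 \<ge> 2\<close> gives \<open>1 \<le> c\<close>, which puts
    \<open>c + \<Delta> * z\<close> for \<open>z \<ge> 0\<close> into the range where
    \<open>g_fun\<close> increases.\<close>
  have c: "0 < c" "1 \<le> c"
    using assms exp_ge_add_one_self[of 1] by linarith+
  \<comment> \<open>\<open>\<kappa>\<close> is the coefficient of \<open>t\<^sup>2\<close> in the
    upper bound, and \<open>gap\<close> is the first-order advantage of the point masses.\<close>
  define \<kappa> where "\<kappa> = 2 * (\<Delta>\<^sup>2 / c)\<^sup>2"
  define gap where "gap = g_fun c \<Delta> (m * m) - g_fun c \<Delta> 0"
  have \<kappa>: "0 < \<kappa>" using assms c by (simp add: \<kappa>_def)
  have "0 < m\<^sup>2" using m0 by (simp add: m_def)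
  then have gap: "0 < gap"
    using g_fun_strict_mono[OF assms(1) c(2), of 0 "m * m"]
    by (simp add: gap_def power2_eq_square)
  \<comment> \<open>The time lies below \<open>\<delta>\<close> and makes the quadratic error at
    most half of the linear gain \<open>t * gap\<close>.\<close>
  define t where "t = min (\<delta> / 2) (gap / (2 * \<kappa>))"
  have t: "0 < t" "t < \<delta>" using \<delta>(1) gap \<kappa> by (auto simp: t_def)
  have "t * \<kappa> \<le> gap / 2"
    using \<kappa> mult_right_mono[of t "gap / (2 * \<kappa>)" \<kappa>] by (simp add: t_def)
  then have small: "t * \<kappa> < gap" using gap by simp
  let ?S = "SUP \<nu>1 \<in> prob_with_mean (1/2). SUP \<nu>2 \<in> prob_with_mean p.
    ereal (parisi_functional c \<Delta> p t ?\<mu> ?\<mu> \<nu>1 \<nu>2)"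
  have lim: "(\<lambda>N. ereal (free_energy c \<Delta> p N t ?\<mu> ?\<mu>)) \<longlonglongrightarrow> ?S"
    using \<delta>(2)[of t] t by (simp add: variational_formula_def)
  have "?S \<le> ereal (t * g_fun c \<Delta> 0 + t\<^sup>2 * \<kappa>)"
  proof (rule LIMSEQ_le[OF lim])
    \<comment> \<open>Only the error \<open>t * c\<^sup>2 / real N\<close> in the upper bound
      depends on \<open>N\<close>, and it vanishes in the limit.\<close>
    have "(\<lambda>N. t * g_fun c \<Delta> 0 + t * c\<^sup>2 / real N + t\<^sup>2 * \<kappa>) \<longlonglongrightarrow> t * g_fun c \<Delta> 0 + 0 + t\<^sup>2 * \<kappa>"
      by (intro tendsto_intros lim_const_over_n)
    then show "(\<lambda>N. ereal (t * g_fun c \<Delta> 0 + t * c\<^sup>2 / real N + t\<^sup>2 * \<kappa>)) \<longlonglongrightarrow> ereal (t * g_fun c \<Delta> 0 + t\<^sup>2 * \<kappa>)"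
      by simp
    have "free_energy c \<Delta> p N t ?\<mu> ?\<mu> \<le> t * g_fun c \<Delta> 0 + t * c\<^sup>2 / real N + t\<^sup>2 * \<kappa>"
      if "nat \<lceil>2 * c\<rceil> \<le> N" for N
    proof -
      have "2 * c \<le> real N" using that by linarith
      from graph_free_energy_le[OF assms(1,2) this t(1), of p] show ?thesis
        unfolding free_energy_null \<kappa>_def by (simp add: power_mult_distrib power_divide mult_ac)
    qed
    then show "\<exists>K. \<forall>N\<ge>K. ereal (free_energy c \<Delta> p N t ?\<mu> ?\<mu>) \<le>
        ereal (t * g_fun c \<Delta> 0 + t * c\<^sup>2 / real N + t\<^sup>2 * \<kappa>)"
      by (intro exI[of _ "nat \<lceil>2 * c\<rceil>"]) simp
  qed
  moreover have "ereal (t * g_fun c \<Delta> (m * m)) \<le> ?S"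
  proof -
    have "point_mass 0 \<in> prob_with_mean (1/2)" "point_mass m \<in> prob_with_mean p"
      using point_mass_mem_prob_with_mean[of "1/2"] point_mass_mem_prob_with_mean[of p] p
      by (auto simp: m_def)
    then have "ereal (parisi_functional c \<Delta> p t ?\<mu> ?\<mu> (point_mass 0) (point_mass m)) \<le> ?S"
      by (meson SUP_upper2 order_refl)
    then show ?thesis
      using parisi_functional_point_masses_ge[OF assms(1,2) t(1) p]
      unfolding m_def by (meson ereal_less_eq(3) order_trans)
  qed
  ultimately have "t * g_fun c \<Delta> (m * m) \<le> t * g_fun c \<Delta> 0 + t\<^sup>2 * \<kappa>"
    by (meson ereal_less_eq(3) order_trans)
  \<comment> \<open>Cancelling \<open>t\<close> contradicts the choice of \<open>t\<close>.\<close>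
  then have "t * gap \<le> t * (t * \<kappa>)"
    by (simp add: gap_def algebra_simps power2_eq_square)
  then show False
    using t small by simp
qed simp

end
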